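(* Let $k$ be a field and let $\Lambda=kQ/I$ be a quadratic monomial algebra. Then $\Lambda$ is absolutely Koszul and its global linearity defect satisfies $\mathrm{gl\,ld}_\Lambda\le 1$.
   Context: A quadratic monomial algebra is $\Lambda=kQ/I$ with $Q$ a finite quiver (vertex set $Q_0$) and $I$ an ideal generated by paths of length $2$; it is not assumed finite-dimensional. It is graded by path length. Graded modules are $\mathbb Z$-graded left $\Lambda$-modules with finite-dimensional homogeneous components and degree-preserving morphisms; $M\langle i\rangle_n=M_{n-i}$. For $x\in Q_0$, $P_x=\Lambda e_x$ is the indecomposable graded projective generated in degree $0$. A graded module $M$ is finitely presented if there is an exact sequence $P^1\to P^0\to M\to0$ with $P^0,P^1$ finite direct sums of modules $P_x\langle i\rangle$. Let $M$ be a finitely presented graded module with minimal graded projective resolution $\cdots\to P^{-k}\to\cdots\to P^{-1}\to P^0\to M\to0$. Writing each differential $d^i\colon P^i\to P^{i+1}$ as a matrix whose entries are right multiplications by linear combinations of paths, decompose $d^i=\sum_{j\ge1}d^i_j$, where $d^i_j$ collects the terms given by paths of length $j$. The linear part $\mathrm{Lin}^\Lambda(P^\bullet)$ is the complex with the same terms as $P^\bullet$ and with differentials $d^i_1$. The linearity defect of $M$ is $\mathrm{ld}_\Lambda(M)=\sup\{i\mid H^{-i}(\mathrm{Lin}^\Lambda(P^\bullet))\ne0\}$. The global linearity defect is $\mathrm{gl\,ld}_\Lambda=\sup\{\mathrm{ld}_\Lambda(M)\mid M \text{ a finitely presented graded } \Lambda\text{-module}\}$. $\Lambda$ is absolutely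 Koszul if every finitely presented graded $\Lambda$-module has finite linearity defect. *)

theory Defs
  imports
    "HOL-Algebra.QuotRing"
    "HOL-Algebra.Module"
    "HOL-Library.Extended_Nat"
    "Graph_Theory.Arc_Walk"
begin

section \<open>Quadratic monomial algebras\<close>

text \<open>
  A finite quiver is a \<^locale>\<open>fin_digraph\<close> (loops and multiple arrows are allowed). A path is a pair
  \<open>(u, p)\<close> of its starting vertex and the list of its arrows in the order in which they are traversed;
  the trivial path at \<open>u\<close> is \<open>(u, [])\<close>.
\<close>

type_synonym ('v, 'a) path = "'v \<times> 'a list"

definition paths :: "('v, 'a) pre_digraph \<Rightarrow> ('v, 'a) path set" where
  "paths Q = {(u, p). \<exists>v. pre_digraph.awalk Q u p v}"

text \<open>
  The path algebra \<open>kQ\<close>: elements are the finitely supported coefficient functions on paths.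
  Paths are composed like functions: \<open>p q\<close> is ``first \<open>q\<close>, then \<open>p\<close>'', so that the left ideal
  generated by the trivial path at \<open>x\<close> is spanned by the paths that start at \<open>x\<close>. The coefficient
  of \<open>f g\<close> at a path \<open>w\<close> is the sum over the factorizations of \<open>w\<close> into an initial part of length \<open>i\<close>
  (an argument of \<open>g\<close>) and the remaining part (an argument of \<open>f\<close>).
\<close>

definition path_algebra :: "('v, 'a) pre_digraph \<Rightarrow> (('v, 'a) path \<Rightarrow> 'k::field) ring" where
  "path_algebra Q =
    \<lparr>carrier = {f. finite {p. f p \<noteq> 0} \<and> {p. f p \<noteq> 0} \<subseteq> paths Q},
     monoid.mult = (\<lambda>f g (u, w). \<Sum>i\<le>length w.
        f (pre_digraph.awlast Q u (take i w), drop i w) * g (u, take i w)),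
     one = (\<lambda>(u, w). if u \<in> verts Q \<and> w = [] then 1 else 0),
     zero = (\<lambda>_. 0),
     add = (\<lambda>f g p. f p + g p)\<rparr>"

definition path_elem :: "('v, 'a) path \<Rightarrow> (('v, 'a) path \<Rightarrow> 'k::field)" where
  "path_elem p = (\<lambda>q. if q = p then 1 else 0)"

definition quadratic_monomial_ideal ::
  "('v, 'a) pre_digraph \<Rightarrow> (('v, 'a) path \<Rightarrow> 'k::field) set \<Rightarrow> bool" where
  "quadratic_monomial_ideal Q I \<longleftrightarrow>
    (\<exists>R \<subseteq> {p \<in> paths Q. length (snd p) = 2}. I = genideal (path_algebra Q) (path_elem ` R))"

type_synonym ('v, 'a, 'k) quot = "(('v, 'a) path \<Rightarrow> 'k) set"

text \<open>The algebra \<open>\<Lambda> = kQ/I\<close>; its elements are the cosets of \<open>I\<close>.\<close>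

definition quiver_algebra ::
  "('v, 'a) pre_digraph \<Rightarrow> (('v, 'a) path \<Rightarrow> 'k::field) set \<Rightarrow> ('v, 'a, 'k) quot ring" where
  "quiver_algebra Q I = path_algebra Q Quot I"

definition coset ::
  "('v, 'a) pre_digraph \<Rightarrow> (('v, 'a) path \<Rightarrow> 'k::field) set \<Rightarrow> (('v, 'a) path \<Rightarrow> 'k) \<Rightarrow> ('v, 'a, 'k) quot" where
  "coset Q I f = a_r_coset (path_algebra Q) I f"

definition scalar ::
  "('v, 'a) pre_digraph \<Rightarrow> (('v, 'a) path \<Rightarrow> 'k::field) set \<Rightarrow> 'k \<Rightarrow> ('v, 'a, 'k) quot" where
  "scalar Q I c = coset Q I (\<lambda>p. c * one (path_algebra Q) p)"

definition idem ::
  "('v, 'a) pre_digraph \<Rightarrow> (('v, 'a) path \<Rightarrow> 'k::field) set \<Rightarrow> 'v \<Rightarrow> ('v, 'a, 'k) quot" where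
  "idem Q I x = coset Q I (path_elem (x, []))"

text \<open>The degree \<open>j\<close> component of \<open>\<Lambda>\<close> in the grading by path length.\<close>

definition homog ::
  "('v, 'a) pre_digraph \<Rightarrow> (('v, 'a) path \<Rightarrow> 'k::field) set \<Rightarrow> int \<Rightarrow> ('v, 'a, 'k) quot set" where
  "homog Q I j = coset Q I `
    {f \<in> carrier (path_algebra Q). \<forall>p. f p \<noteq> 0 \<longrightarrow> int (length (snd p)) = j}"

text \<open>The ideal of \<open>\<Lambda>\<close> generated by the arrows, that is, \<open>\<Lambda>\<^sub>1 \<oplus> \<Lambda>\<^sub>2 \<oplus> \<dots>\<close>.\<close>

definition arrow_ideal ::
  "('v, 'a) pre_digraph \<Rightarrow> (('v, 'a) path \<Rightarrow> 'k::field) set \<Rightarrow> ('v, 'a, 'k) quot set" where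
  "arrow_ideal Q I = coset Q I `
    {f \<in> carrier (path_algebra Q). \<forall>p. f p \<noteq> 0 \<longrightarrow> 1 \<le> length (snd p)}"

text \<open>
  The part of an element \<open>X\<close> of \<open>\<Lambda>\<close> given by the paths of length \<open>j\<close>: discard from the
  representatives of the coset \<open>X\<close> all paths of other lengths and return to cosets by adding \<open>I\<close>.
  The result is a single coset because \<open>I\<close> is homogeneous.
\<close>

definition length_part ::
  "('v, 'a) pre_digraph \<Rightarrow> (('v, 'a) path \<Rightarrow> 'k::field) set \<Rightarrow> nat \<Rightarrow> ('v, 'a, 'k) quot \<Rightarrow> ('v, 'a, 'k) quot" where
  "length_part Q I j X =
    I <+>\<^bsub>path_algebra Q\<^esub> (\<lambda>f p. if length (snd p) = j then f p else 0) ` X"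


section \<open>Graded modules\<close>

text \<open>
  The locale \<^locale>\<open>module\<close> of the library requires a commutative ring. The ring multiplication fields
  of the module record are not used.
\<close>

locale left_module = R?: ring R + M?: abelian_group M
  for R :: "('r, 'x) ring_scheme" (structure) and M :: "('r, 'm, 'y) module_scheme" (structure) +
  assumes smult_closed: "\<lbrakk>a \<in> carrier R; m \<in> carrier M\<rbrakk> \<Longrightarrow> a \<odot>\<^bsub>M\<^esub> m \<in> carrier M"
    and smult_l_distr: "\<lbrakk>a \<in> carrier R; b \<in> carrier R; m \<in> carrier M\<rbrakk> \<Longrightarrow>
      (a \<oplus>\<^bsub>R\<^esub> b) \<odot>\<^bsub>M\<^esub> m = a \<odot>\<^bsub>M\<^esub> m \<oplus>\<^bsub>M\<^esub> b \<odot>\<^bsub>M\<^esub> m"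
    and smult_r_distr: "\<lbrakk>a \<in> carrier R; m \<in> carrier M; n \<in> carrier M\<rbrakk> \<Longrightarrow>
      a \<odot>\<^bsub>M\<^esub> (m \<oplus>\<^bsub>M\<^esub> n) = a \<odot>\<^bsub>M\<^esub> m \<oplus>\<^bsub>M\<^esub> a \<odot>\<^bsub>M\<^esub> n"
    and smult_assoc: "\<lbrakk>a \<in> carrier R; b \<in> carrier R; m \<in> carrier M\<rbrakk> \<Longrightarrow>
      (a \<otimes>\<^bsub>R\<^esub> b) \<odot>\<^bsub>M\<^esub> m = a \<odot>\<^bsub>M\<^esub> (b \<odot>\<^bsub>M\<^esub> m)"
    and smult_one: "m \<in> carrier M \<Longrightarrow> \<one>\<^bsub>R\<^esub> \<odot>\<^bsub>M\<^esub> m = m"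

record ('r, 'm) gmodule = "('r, 'm) module" +
  comp :: "int \<Rightarrow> 'm set"

text \<open>
  \<open>M\<close> is the internal direct sum of the subgroups \<open>comp M n\<close>, the grading is compatible with the
  path length grading of \<open>\<Lambda>\<close>, and each \<open>comp M n\<close> is spanned over \<open>k\<close> by a finite set.
\<close>

definition graded_module ::
  "('v, 'a) pre_digraph \<Rightarrow> (('v, 'a) path \<Rightarrow> 'k::field) set \<Rightarrow> (('v, 'a, 'k) quot, 'm) gmodule \<Rightarrow> bool" where
  "graded_module Q I M \<longleftrightarrow>
    left_module (quiver_algebra Q I) M \<and>
    (\<forall>n. additive_subgroup (comp M n) M) \<and>
    (\<forall>m \<in> carrier M. \<exists>!c. (\<forall>n. c n \<in> comp M n) \<and> finite {n. c n \<noteq> \<zero>\<^bsub>M\<^esub>} \<and>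
       m = finsum M c {n. c n \<noteq> \<zero>\<^bsub>M\<^esub>}) \<and>
    (\<forall>i n. \<forall>a \<in> homog Q I i. \<forall>m \<in> comp M n. a \<odot>\<^bsub>M\<^esub> m \<in> comp M (i + n)) \<and>
    (\<forall>n. \<exists>S \<subseteq> comp M n. finite S \<and>
       (\<forall>m \<in> comp M n. \<exists>c. m = finsum M (\<lambda>s. scalar Q I (c s) \<odot>\<^bsub>M\<^esub> s) S))"

definition graded_hom ::
  "('v, 'a) pre_digraph \<Rightarrow> (('v, 'a) path \<Rightarrow> 'k::field) set \<Rightarrow> (('v, 'a, 'k) quot, 'm) gmodule \<Rightarrow>
    (('v, 'a, 'k) quot, 'n) gmodule \<Rightarrow> ('m \<Rightarrow> 'n) \<Rightarrow> bool" where
  "graded_hom Q I M N h \<longleftrightarrow>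
    h \<in> carrier M \<rightarrow> carrier N \<and>
    (\<forall>m \<in> carrier M. \<forall>m' \<in> carrier M. h (m \<oplus>\<^bsub>M\<^esub> m') = h m \<oplus>\<^bsub>N\<^esub> h m') \<and>
    (\<forall>a \<in> carrier (quiver_algebra Q I). \<forall>m \<in> carrier M. h (a \<odot>\<^bsub>M\<^esub> m) = a \<odot>\<^bsub>N\<^esub> h m) \<and>
    (\<forall>n. h ` comp M n \<subseteq> comp N n)"

definition exact_at ::
  "('r, 'l) gmodule \<Rightarrow> ('l \<Rightarrow> 'm) \<Rightarrow> ('r, 'm) gmodule \<Rightarrow> ('m \<Rightarrow> 'n) \<Rightarrow> ('r, 'n) gmodule \<Rightarrow> bool" where
  "exact_at L g M h N \<longleftrightarrow> g ` carrier L = {m \<in> carrier M. h m = \<zero>\<^bsub>N\<^esub>}"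


section \<open>Direct sums of shifted indecomposable projectives\<close>

definition proj :: "('v, 'a) pre_digraph \<Rightarrow> (('v, 'a) path \<Rightarrow> 'k::field) set \<Rightarrow> 'v \<Rightarrow> ('v, 'a, 'k) quot set" where
  "proj Q I x = (\<lambda>a. a \<otimes>\<^bsub>quiver_algebra Q I\<^esub> idem Q I x) ` carrier (quiver_algebra Q I)"

text \<open>
  A family \<open>G\<close> of generators: \<open>G b = Some (x, i)\<close> stands for a summand \<open>P\<^sub>x\<langle>i\<rangle>\<close> with index \<open>b\<close>.
  Since the vertices are finite in number and the homogeneous components finite-dimensional,
  countably many indices suffice.
\<close>

type_synonym 'v gens = "nat \<rightharpoonup> 'v \<times> int"

text \<open>
  The direct sum of the \<open>P\<^sub>x\<langle>i\<rangle>\<close> over all \<open>b\<close> with \<open>G b = Some (x, i)\<close>. The degree \<open>n\<close> component of \<open>P\<^sub>x\<langle>i\<rangle>\<close> is the degree \<open>n - i\<close>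
  component of \<open>P\<^sub>x\<close>.
\<close>

definition proj_sum ::
  "('v, 'a) pre_digraph \<Rightarrow> (('v, 'a) path \<Rightarrow> 'k::field) set \<Rightarrow> 'v gens \<Rightarrow>
    (('v, 'a, 'k) quot, nat \<Rightarrow> ('v, 'a, 'k) quot) gmodule" where
  "proj_sum Q I G = (let L = quiver_algebra Q I;
      C = {f. finite {b. f b \<noteq> \<zero>\<^bsub>L\<^esub>} \<and>
        (\<forall>b. case G b of None \<Rightarrow> f b = \<zero>\<^bsub>L\<^esub> | Some (x, i) \<Rightarrow> f b \<in> proj Q I x)} in
    \<lparr>carrier = C,
     monoid.mult = undefined,
     one = undefined,
     zero = (\<lambda>_. \<zero>\<^bsub>L\<^esub>),
     add = (\<lambda>f g b. f b \<oplus>\<^bsub>L\<^esub> g b),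
     smult = (\<lambda>a f b. a \<otimes>\<^bsub>L\<^esub> f b),
     comp = (\<lambda>n. {f \<in> C. \<forall>b x i. G b = Some (x, i) \<longrightarrow> f b \<in> homog Q I (n - i)})\<rparr>)"

definition gen ::
  "('v, 'a) pre_digraph \<Rightarrow> (('v, 'a) path \<Rightarrow> 'k::field) set \<Rightarrow> 'v gens \<Rightarrow> nat \<Rightarrow> nat \<Rightarrow> ('v, 'a, 'k) quot" where
  "gen Q I G a = (\<lambda>b. case G a of
      Some (x, i) \<Rightarrow> if b = a then idem Q I x else \<zero>\<^bsub>quiver_algebra Q I\<^esub>
    | None \<Rightarrow> \<zero>\<^bsub>quiver_algebra Q I\<^esub>)"

definition finitely_presented ::
  "('v, 'a) pre_digraph \<Rightarrow> (('v, 'a) path \<Rightarrow> 'k::field) set \<Rightarrow> (('v, 'a, 'k) quot, 'm) gmodule \<Rightarrow> bool" where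
  "finitely_presented Q I M \<longleftrightarrow>
    graded_module Q I M \<and>
    (\<exists>G1 G0 g h. finite (dom G1) \<and> fst ` ran G1 \<subseteq> verts Q \<and>
       finite (dom G0) \<and> fst ` ran G0 \<subseteq> verts Q \<and>
       graded_hom Q I (proj_sum Q I G1) (proj_sum Q I G0) g \<and>
       graded_hom Q I (proj_sum Q I G0) M h \<and>
       exact_at (proj_sum Q I G1) g (proj_sum Q I G0) h M \<and>
       h ` carrier (proj_sum Q I G0) = carrier M)"


section \<open>Minimal resolutions and the linearity defect\<close>

text \<open>
  A minimal graded projective resolution
  \<open>\<dots> \<rightarrow> P\<^sup>-\<^sup>2 \<rightarrow> P\<^sup>-\<^sup>1 \<rightarrow> P\<^sup>0 \<rightarrow> M \<rightarrow> 0\<close> of \<open>M\<close>: here \<open>P\<^sup>-\<^sup>k\<close> is \<open>proj_sum Q I (G k)\<close>, the map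
  \<open>d k\<close> goes from \<open>P\<^sup>-\<^sup>(\<^sup>k\<^sup>+\<^sup>1\<^sup>)\<close> to \<open>P\<^sup>-\<^sup>k\<close>, and \<open>h\<close> is the augmentation. Minimality says that the image
  of each differential lies in the arrow ideal times its target.
\<close>

definition minimal_resolution ::
  "('v, 'a) pre_digraph \<Rightarrow> (('v, 'a) path \<Rightarrow> 'k::field) set \<Rightarrow> (('v, 'a, 'k) quot, 'm) gmodule \<Rightarrow>
    (nat \<Rightarrow> 'v gens) \<Rightarrow>
    (nat \<Rightarrow> (nat \<Rightarrow> ('v, 'a, 'k) quot) \<Rightarrow> (nat \<Rightarrow> ('v, 'a, 'k) quot)) \<Rightarrow>
    ((nat \<Rightarrow> ('v, 'a, 'k) quot) \<Rightarrow> 'm) \<Rightarrow> bool" where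
  "minimal_resolution Q I M G d h \<longleftrightarrow> (let P = (\<lambda>k. proj_sum Q I (G k)) in
    (\<forall>k. fst ` ran (G k) \<subseteq> verts Q \<and> graded_module Q I (P k)) \<and>
    graded_hom Q I (P 0) M h \<and>
    (\<forall>k. graded_hom Q I (P (Suc k)) (P k) (d k)) \<and>
    h ` carrier (P 0) = carrier M \<and>
    exact_at (P 1) (d 0) (P 0) h M \<and>
    (\<forall>k. exact_at (P (Suc (Suc k))) (d (Suc k)) (P (Suc k)) (d k) (P k)) \<and>
    (\<forall>k. \<forall>f \<in> carrier (P (Suc k)). \<forall>b. d k f b \<in> arrow_ideal Q I))"

text \<open>
  A homomorphism \<open>d\<close> out of \<open>proj_sum Q I G\<close> is right multiplication by the matrix with entries
  \<open>d (gen Q I G a) b\<close>; its part \<open>d\<^sub>j\<close> is right multiplication by the length \<open>j\<close> parts of the entries.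
\<close>

definition map_part ::
  "('v, 'a) pre_digraph \<Rightarrow> (('v, 'a) path \<Rightarrow> 'k::field) set \<Rightarrow> 'v gens \<Rightarrow> nat \<Rightarrow>
    ((nat \<Rightarrow> ('v, 'a, 'k) quot) \<Rightarrow> (nat \<Rightarrow> ('v, 'a, 'k) quot)) \<Rightarrow>
    (nat \<Rightarrow> ('v, 'a, 'k) quot) \<Rightarrow> (nat \<Rightarrow> ('v, 'a, 'k) quot)" where
  "map_part Q I G j d f = (let L = quiver_algebra Q I in
    (\<lambda>b. finsum L (\<lambda>a. f a \<otimes>\<^bsub>L\<^esub> length_part Q I j (d (gen Q I G a) b)) {a. f a \<noteq> \<zero>\<^bsub>L\<^esub>}))"

definition lin_cocycles ::
  "('v, 'a) pre_digraph \<Rightarrow> (('v, 'a) path \<Rightarrow> 'k::field) set \<Rightarrow> (nat \<Rightarrow> 'v gens) \<Rightarrow>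
    (nat \<Rightarrow> (nat \<Rightarrow> ('v, 'a, 'k) quot) \<Rightarrow> (nat \<Rightarrow> ('v, 'a, 'k) quot)) \<Rightarrow> nat \<Rightarrow>
    (nat \<Rightarrow> ('v, 'a, 'k) quot) set" where
  "lin_cocycles Q I G d i = (case i of
      0 \<Rightarrow> carrier (proj_sum Q I (G 0))
    | Suc k \<Rightarrow> {f \<in> carrier (proj_sum Q I (G (Suc k))).
        map_part Q I (G (Suc k)) 1 (d k) f = \<zero>\<^bsub>proj_sum Q I (G k)\<^esub>})"

definition lin_coboundaries ::
  "('v, 'a) pre_digraph \<Rightarrow> (('v, 'a) path \<Rightarrow> 'k::field) set \<Rightarrow> (nat \<Rightarrow> 'v gens) \<Rightarrow>
    (nat \<Rightarrow> (nat \<Rightarrow> ('v, 'a, 'k) quot) \<Rightarrow> (nat \<Rightarrow> ('v, 'a, 'k) quot)) \<Rightarrow> nat \<Rightarrow>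
    (nat \<Rightarrow> ('v, 'a, 'k) quot) set" where
  "lin_coboundaries Q I G d i =
    map_part Q I (G (Suc i)) 1 (d i) ` carrier (proj_sum Q I (G (Suc i)))"

text \<open>The additive group of \<open>H\<^sup>-\<^sup>i\<close> of the linear part of the resolution.\<close>

definition lin_cohomology ::
  "('v, 'a) pre_digraph \<Rightarrow> (('v, 'a) path \<Rightarrow> 'k::field) set \<Rightarrow> (nat \<Rightarrow> 'v gens) \<Rightarrow>
    (nat \<Rightarrow> (nat \<Rightarrow> ('v, 'a, 'k) quot) \<Rightarrow> (nat \<Rightarrow> ('v, 'a, 'k) quot)) \<Rightarrow> nat \<Rightarrow>
    (nat \<Rightarrow> ('v, 'a, 'k) quot) set monoid" where
  "lin_cohomology Q I G d i =
    (add_monoid (proj_sum Q I (G i))\<lparr>carrier := lin_cocycles Q I G d i\<rparr>) Mod lin_coboundaries Q I G d i"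

text \<open>
  A finitely presented graded module has a minimal resolution, which is unique up to isomorphism, and
  an isomorphism of minimal resolutions induces one of their linear parts. So every minimal resolution
  of \<open>M\<close> contributes the same set of degrees \<open>i\<close>, and the supremum does not depend on a choice.
  The linearity defect of the zero module is \<open>0\<close>.
\<close>

definition linearity_defect ::
  "('v, 'a) pre_digraph \<Rightarrow> (('v, 'a) path \<Rightarrow> 'k::field) set \<Rightarrow> (('v, 'a, 'k) quot, 'm) gmodule \<Rightarrow> enat" where
  "linearity_defect Q I M = Sup {enat i | i G d h.
    minimal_resolution Q I M G d h \<and>
    carrier (lin_cohomology Q I G d i) \<noteq> {\<one>\<^bsub>lin_cohomology Q I G d i\<^esub>}}"

text \<open>
  The following two notions range over the modules whose elements have type \<open>'m\<close>. They are used
  with arbitrary \<open>'m\<close>; a type containing the cosets of submodules of the modules \<open>proj_sum Q I G\<close>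
  already has a copy of every finitely presented graded module.
\<close>

definition global_linearity_defect ::
  "('v, 'a) pre_digraph \<Rightarrow> (('v, 'a) path \<Rightarrow> 'k::field) set \<Rightarrow> 'm itself \<Rightarrow> enat" where
  "global_linearity_defect Q I (_ :: 'm itself) =
    Sup {linearity_defect Q I M | M :: (('v, 'a, 'k) quot, 'm) gmodule. finitely_presented Q I M}"

definition absolutely_Koszul ::
  "('v, 'a) pre_digraph \<Rightarrow> (('v, 'a) path \<Rightarrow> 'k::field) set \<Rightarrow> 'm itself \<Rightarrow> bool" where
  "absolutely_Koszul Q I (_ :: 'm itself) \<longleftrightarrow>
    (\<forall>M :: (('v, 'a, 'k) quot, 'm) gmodule. finitely_presented Q I M \<longrightarrow> linearity_defect Q I M < \<infinity>)"

end

theory Submission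
  imports Defs
begin

text \<open>
  The nonzero paths, those that do not run through a relation, form a basis of \<open>\<Lambda>\<close>. Because the
  relations have length \<open>2\<close>, whether \<open>a p\<close> is nonzero, for an arrow \<open>a\<close> and a nonzero path \<open>p\<close> of positive
  length, only depends on \<open>a\<close> and on the last arrow of \<open>p\<close>. This controls the kernel of every
  homomorphism \<open>d: P \<rightarrow> P'\<close> between direct sums of projectives \<open>P\<^sub>x\<langle>i\<rangle>\<close>. Let \<open>J\<close> be the arrow ideal and let \<open>f\<close> be an
  element of the kernel that only involves paths of length at least \<open>2\<close>. Collect its paths by their
  last arrow: \<open>f = \<Sum>\<^sub>a a f\<^sub>a\<close>. Different arrows \<open>a\<close> produce different paths, so \<open>a d(f\<^sub>a) = 0\<close> for every \<open>a\<close>.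
  Every path of \<open>f\<^sub>a\<close> ends in some arrow \<open>c\<close> with \<open>a c \<noteq> 0\<close>; hence so does every path of \<open>d(f\<^sub>a)\<close>, and none
  of them is killed by \<open>a\<close>. So \<open>d(f\<^sub>a) = 0\<close> (\<open>kernel_strip\<close>). Iterating, an element of
  \<open>ker d \<inter> J\<^sup>j\<^sup>+\<^sup>1 P\<close> lies in \<open>J\<^sup>j (ker d)\<close>. If \<open>e\<close> is a homomorphism onto \<open>ker d\<close>, such an element is therefore
  the image under \<open>e\<close> of an element that only involves paths of length at least \<open>j\<close> (\<open>kernel_lift\<close>).

  Consider four consecutive terms \<open>P\<^sub>3 \<rightarrow> P\<^sub>2 \<rightarrow> P\<^sub>1 \<rightarrow> P\<^sub>0\<close> of a minimal resolution, with maps \<open>c\<close>, \<open>d\<close>, \<open>e\<close> in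
  this order, and a cocycle \<open>f \<in> P\<^sub>2\<close> of the linear part. As the linear part raises the lengths of paths by
  exactly one, \<open>f\<close> may be assumed to involve only paths of one length \<open>j\<close>. The terms of lowest possible
  length \<open>j + 1\<close> in \<open>d f\<close> form \<open>d\<^sub>1 f = 0\<close>, so \<open>d f \<in> ker e\<close> only involves paths of length at least \<open>j + 2\<close>
  and \<open>d f = d g\<close> with \<open>g\<close> of lengths at least \<open>j + 1\<close>. Then \<open>f - g \<in> ker d\<close> has lengths at least \<open>j\<close>, so it is
  \<open>c v\<close> with \<open>v\<close> of lengths at least \<open>j - 1\<close>. In length \<open>j\<close> this reads \<open>f = c\<^sub>1 v'\<close>, where \<open>v'\<close> is the part of \<open>v\<close> of
  length \<open>j - 1\<close>; for \<open>j = 0\<close>, minimality gives \<open>f = 0\<close>. Thus the linear part is exact at \<open>P\<^sub>2\<close>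
  (\<open>linear_part_exact\<close>). The argument applies to \<open>H\<^sup>-\<^sup>i\<close> as soon as two differentials between
  projectives follow, that is, for \<open>i \<ge> 2\<close>, and every linearity defect is at most \<open>1\<close>.
\<close>

section \<open>The path algebra\<close>

lemma awlast_append:
  "pre_digraph.awlast Q (pre_digraph.awlast Q u p) q = pre_digraph.awlast Q u (p @ q)"
  by (simp add: pre_digraph.awalk_verts_conv)

lemma awlast_Nil [simp]: "pre_digraph.awlast Q u [] = u"
  by (simp add: pre_digraph.awalk_verts_conv)

lemma path_algebra_mult:
  "(f \<otimes>\<^bsub>path_algebra Q\<^esub> g) (u, w) = (\<Sum>i\<le>length w.
     f (pre_digraph.awlast Q u (take i w), drop i w) * g (u, take i w))"
  by (simp add: path_algebra_def)

lemma path_algebra_simps: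
  "f \<in> carrier (path_algebra Q) \<longleftrightarrow> finite {p. f p \<noteq> 0} \<and> {p. f p \<noteq> 0} \<subseteq> paths Q"
  "f \<oplus>\<^bsub>path_algebra Q\<^esub> g = (\<lambda>p. f p + g p)"
  "\<zero>\<^bsub>path_algebra Q\<^esub> = (\<lambda>_. 0)"
  "\<one>\<^bsub>path_algebra Q\<^esub> = (\<lambda>(u, w). if u \<in> verts Q \<and> w = [] then 1 else 0)"
  by (simp_all add: path_algebra_def)

lemma path_elem_mult:
  fixes Q :: "('v, 'a) pre_digraph"
  assumes "v = pre_digraph.awlast Q u p"
  shows "path_elem (v, q) \<otimes>\<^bsub>path_algebra Q\<^esub> path_elem (u, p) =
    (path_elem (u, p @ q) :: ('v, 'a) path \<Rightarrow> 'k::field)"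
proof
  fix x :: "('v, 'a) path"
  obtain u' w where x: "x = (u', w)" by fastforce
  show "(path_elem (v, q) \<otimes>\<^bsub>path_algebra Q\<^esub> path_elem (u, p)) x =
    (path_elem (u, p @ q) x :: 'k)"
  proof (cases "u' = u \<and> w = p @ q")
    case True
    have take: "take i w = p \<longleftrightarrow> i = length p" if "i \<le> length w" for i
    proof
      assume "take i w = p"
      with that show "i = length p" by (metis length_take min.absorb2)
    qed (use True in simp)
    have *: "(\<Sum>i\<le>length w. path_elem (v, q) (pre_digraph.awlast Q u' (take i w), drop i w) *
        path_elem (u, p) (u', take i w)) = (\<Sum>i\<le>length w. if i = length p then 1 else (0::'k))"
    proof (intro sum.cong refl)
      fix i assume "i \<in> {..length w}"
      with take show "path_elem (v, q) (pre_digraph.awlast Q u' (take i w), drop i w) *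
          path_elem (u, p) (u', take i w) = (if i = length p then 1 else (0::'k))"
        using True assms by (cases "take i w = p") (simp_all add: path_elem_def)
    qed
    have "path_elem (u, p @ q) x = (1::'k)" using True by (simp add: x path_elem_def)
    then show ?thesis using True unfolding x path_algebra_mult * by simp
  next
    case False
    then have *: "path_elem (v, q) (pre_digraph.awlast Q u' (take i w), drop i w) *
        path_elem (u, p) (u', take i w) = (0::'k)" for i
      by (auto simp: path_elem_def)
    have "path_elem (u, p @ q) x = (0::'k)" using False by (auto simp: x path_elem_def)
    then show ?thesis unfolding x path_algebra_mult * by simp
  qed
qed

context wf_digraph
begin

lemma path_iff: "(u, p) \<in> paths G \<longleftrightarrow> awalk u p (awlast u p)"
  by (auto simp: paths_def)

lemma paths_Nil [simp]: "(u, []) \<in> paths G \<longleftrightarrow> u \<in> verts G"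
  by (simp add: path_iff awalk_Nil_iff)

lemma paths_append: "(u, p @ q) \<in> paths G \<longleftrightarrow> (u, p) \<in> paths G \<and> (awlast u p, q) \<in> paths G"
  by (auto simp: path_iff awalk_append_iff awlast_append[symmetric])

lemma paths_single: "(u, [a]) \<in> paths G \<longleftrightarrow> a \<in> arcs G \<and> u = tail G a"
  by (auto simp: path_iff awalk_simps)

lemma path_algebra_mult_closed:
  fixes f g :: "('a, 'b) path \<Rightarrow> 'k::field"
  assumes f: "f \<in> carrier (path_algebra G)" and g: "g \<in> carrier (path_algebra G)"
  shows "f \<otimes>\<^bsub>path_algebra G\<^esub> g \<in> carrier (path_algebra G)"
proof -
  have *: "\<exists>i\<le>length w. f (awlast u (take i w), drop i w) \<noteq> 0 \<and> g (u, take i w) \<noteq> 0"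
    if "(f \<otimes>\<^bsub>path_algebra G\<^esub> g) (u, w) \<noteq> 0" for u w
    using that by (auto simp: path_algebra_mult elim!: sum.not_neutral_contains_not_neutral)
  have "{p. (f \<otimes>\<^bsub>path_algebra G\<^esub> g) p \<noteq> 0} \<subseteq>
      (\<lambda>((v, q), (u, p)). (u, p @ q)) ` ({p. f p \<noteq> 0} \<times> {p. g p \<noteq> 0})"
    by (force dest!: *)
  moreover have "(u, w) \<in> paths G" if "(f \<otimes>\<^bsub>path_algebra G\<^esub> g) (u, w) \<noteq> 0" for u w
  proof -
    from *[OF that] obtain i where "(u, take i w) \<in> paths G" "(awlast u (take i w), drop i w) \<in> paths G"
      using f g unfolding path_algebra_simps by blast
    then show ?thesis using paths_append[of u "take i w" "drop i w"] by simp
  qed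
  ultimately show ?thesis
    using f g by (auto simp: path_algebra_simps intro: finite_subset)
qed

lemma path_algebra_mult_assoc:
  fixes f g h :: "('a, 'b) path \<Rightarrow> 'k::field"
  shows "(f \<otimes>\<^bsub>path_algebra G\<^esub> g) \<otimes>\<^bsub>path_algebra G\<^esub> h = f \<otimes>\<^bsub>path_algebra G\<^esub> (g \<otimes>\<^bsub>path_algebra G\<^esub> h)"
proof
  fix x :: "('a, 'b) path"
  obtain u w where x: "x = (u, w)" by fastforce
  let ?n = "length w"
  \<comment> \<open>Both sides sum over the two cutting points \<open>i \<le> m\<close> of \<open>w\<close>.\<close>
  define T where "T i m = f (awlast u (take m w), drop m w) *
    g (awlast u (take i w), drop i (take m w)) * h (u, take i w)" for i m
  have "((f \<otimes>\<^bsub>path_algebra G\<^esub> g) \<otimes>\<^bsub>path_algebra G\<^esub> h) x = (\<Sum>i\<le>?n. \<Sum>j\<le>?n - i. T i (i + j))"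
    by (simp add: x path_algebra_mult T_def awlast_append sum_distrib_right drop_take
        take_add add.commute)
  also have "\<dots> = (\<Sum>(i, j)\<in>{(i, j). i + j \<le> ?n}. T i (i + j))"
    by (subst sum.Sigma) (auto intro!: sum.cong)
  also have "\<dots> = (\<Sum>m\<le>?n. \<Sum>i\<le>m. T i m)"
    by (subst sum.triangle_reindex_eq) simp
  also have "\<dots> = (f \<otimes>\<^bsub>path_algebra G\<^esub> (g \<otimes>\<^bsub>path_algebra G\<^esub> h)) x"
    unfolding x path_algebra_mult T_def sum_distrib_left
    by (intro sum.cong refl) (auto intro!: sum.cong simp: min.absorb1 min.absorb2 mult.assoc)
  finally show "((f \<otimes>\<^bsub>path_algebra G\<^esub> g) \<otimes>\<^bsub>path_algebra G\<^esub> h) x =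
      (f \<otimes>\<^bsub>path_algebra G\<^esub> (g \<otimes>\<^bsub>path_algebra G\<^esub> h)) x" .
qed

end

context fin_digraph
begin

lemma ring_path_algebra: "ring (path_algebra G :: (('a, 'b) path \<Rightarrow> 'k::field) ring)"
  (is "ring ?A")
proof (rule ringI)
  show "abelian_group ?A"
  proof (rule abelian_groupI)
    fix f g assume "f \<in> carrier ?A" "g \<in> carrier ?A"
    moreover have "{p. f p + g p \<noteq> 0} \<subseteq> {p. f p \<noteq> 0} \<union> {p. g p \<noteq> 0}" by auto
    ultimately show "f \<oplus>\<^bsub>?A\<^esub> g \<in> carrier ?A"
      by (auto simp: path_algebra_simps intro: finite_subset)
  next
    fix f assume "f \<in> carrier ?A"
    then show "\<exists>g\<in>carrier ?A. g \<oplus>\<^bsub>?A\<^esub> f = \<zero>\<^bsub>?A\<^esub>"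
      by (intro bexI[of _ "\<lambda>p. - f p"]) (auto simp: path_algebra_simps)
  qed (auto simp: path_algebra_simps)
  have one: "\<one>\<^bsub>?A\<^esub> \<in> carrier ?A"
  proof -
    have "{p. \<one>\<^bsub>?A\<^esub> p \<noteq> 0} \<subseteq> (\<lambda>u. (u, [])) ` verts G"
      by (auto simp: path_algebra_simps split: if_splits)
    then show ?thesis
      by (auto simp: path_algebra_simps intro: finite_subset split: if_splits)
  qed
  have l_one: "\<one>\<^bsub>?A\<^esub> \<otimes>\<^bsub>?A\<^esub> f = f" if f: "f \<in> carrier ?A" for f
  proof
    fix x :: "('a, 'b) path"
    obtain u w where x: "x = (u, w)" by fastforce
    have "(\<one>\<^bsub>?A\<^esub> \<otimes>\<^bsub>?A\<^esub> f) x = (\<Sum>i\<le>length w. if i = length w then f x else 0)"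
      unfolding x path_algebra_mult using f awlast_in_verts[of u w]
      by (intro sum.cong refl) (auto simp: path_algebra_simps path_iff x awalk_def)
    then show "(\<one>\<^bsub>?A\<^esub> \<otimes>\<^bsub>?A\<^esub> f) x = f x" by simp
  qed
  have r_one: "f \<otimes>\<^bsub>?A\<^esub> \<one>\<^bsub>?A\<^esub> = f" if f: "f \<in> carrier ?A" for f
  proof
    fix x :: "('a, 'b) path"
    obtain u w where x: "x = (u, w)" by fastforce
    have "(f \<otimes>\<^bsub>?A\<^esub> \<one>\<^bsub>?A\<^esub>) x = (\<Sum>i\<le>length w. if i = 0 then f x else 0)"
      unfolding x path_algebra_mult using f
      by (intro sum.cong refl) (auto simp: path_algebra_simps path_iff x awalk_def)
    then show "(f \<otimes>\<^bsub>?A\<^esub> \<one>\<^bsub>?A\<^esub>) x = f x" by simp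
  qed
  show "monoid ?A"
    using one l_one r_one
    by (intro monoidI) (auto simp: path_algebra_mult_closed path_algebra_mult_assoc)
qed (auto simp: fun_eq_iff path_algebra_mult path_algebra_simps(2) algebra_simps sum.distrib)

end

section \<open>Monomial ideals and coefficients\<close>

lemma not_successively_split:
  "\<not> successively P xs \<Longrightarrow> \<exists>ys a b zs. xs = ys @ [a, b] @ zs \<and> \<not> P a b"
proof (induction P xs rule: successively.induct)
  case (3 P x y xs)
  show ?case
  proof (cases "P x y")
    case True
    with 3 obtain ys a b zs where "y # xs = ys @ [a, b] @ zs" "\<not> P a b" by auto
    then show ?thesis by (intro exI[of _ "x # ys"]) auto
  next
    case False
    then show ?thesis by (intro exI[of _ "[]"]) auto
  qed
qed auto

locale quadratic_monomial = fin_digraph Q for Q :: "('v, 'a) pre_digraph" +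
  fixes R :: "('v, 'a) path set" and I :: "(('v, 'a) path \<Rightarrow> 'k::field) set"
  assumes relations: "R \<subseteq> {p \<in> paths Q. length (snd p) = 2}"
    and I_def: "I = genideal (path_algebra Q) (path_elem ` R)"
begin

abbreviation A :: "(('v, 'a) path \<Rightarrow> 'k) ring" where "A \<equiv> path_algebra Q"
abbreviation L :: "('v, 'a, 'k) quot ring" where "L \<equiv> quiver_algebra Q I"

sublocale A: ring A by (rule ring_path_algebra)

text \<open>Normal forms: the paths that do not run through a relation, that is, the nonzero paths of \<open>\<Lambda>\<close>.\<close>

definition nf :: "('v, 'a) path set" where
  "nf = {(u, p) \<in> paths Q. successively (\<lambda>a b. (tail Q a, [a, b]) \<notin> R) p}"

lemma nf_append:
  "(u, p @ q) \<in> nf \<longleftrightarrow> (u, p) \<in> nf \<and> (awlast u p, q) \<in> nf \<and>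
     (p \<noteq> [] \<and> q \<noteq> [] \<longrightarrow> (tail Q (last p), [last p, hd q]) \<notin> R)"
  by (auto simp: nf_def paths_append successively_append_iff)

lemma nf_Nil [simp]: "(u, []) \<in> nf \<longleftrightarrow> u \<in> verts Q"
  by (auto simp: nf_def)

lemma nf_single: "(u, [a]) \<in> nf \<longleftrightarrow> a \<in> arcs Q \<and> u = tail Q a"
  by (auto simp: nf_def paths_single)

lemma nf_take: "(u, w) \<in> nf \<Longrightarrow> (u, take i w) \<in> nf"
  using nf_append[of u "take i w" "drop i w"] by simp

lemma nf_drop: "(u, w) \<in> nf \<Longrightarrow> (awlast u (take i w), drop i w) \<in> nf"
  using nf_append[of u "take i w" "drop i w"] by simp

lemma nf_paths: "nf \<subseteq> paths Q"
  by (auto simp: nf_def)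

text \<open>
  Whether a nonzero path stays nonzero when an arrow is appended only depends on its last arrow. This
  is the property of quadratic relations on which the theorem rests.
\<close>

lemma nf_snoc2: "(u, p @ [a, b]) \<in> nf \<longleftrightarrow> (u, p @ [a]) \<in> nf \<and> (tail Q a, [a, b]) \<in> nf"
proof -
  have "awlast u (p @ [a]) = awlast (tail Q a) [a]"
    by (simp add: awalk_verts_conv)
  then show ?thesis
    using nf_append[of u "p @ [a]" "[b]"] nf_append[of "tail Q a" "[a]" "[b]"] nf_append[of u p "[a]"]
    by (auto simp: nf_single)
qed

lemma path_elem_carrier: "p \<in> paths Q \<Longrightarrow> path_elem p \<in> carrier A"
  by (auto simp: path_algebra_simps path_elem_def split: if_splits)

lemma ideal_I: "ideal I A"
  unfolding I_def using relations by (intro A.genideal_ideal) (auto intro: path_elem_carrier)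

sublocale I: ideal I A by (rule ideal_I)

sublocale L: ring L
  unfolding quiver_algebra_def by (rule I.quotient_is_ring)

text \<open>
  An initial or final part of a nonzero path is nonzero, so a product that contributes to a nonzero
  path has both of its factors among the nonzero paths.
\<close>

lemma ideal_zero_on_nf: "ideal {f \<in> carrier A. \<forall>p\<in>nf. f p = 0} A"
proof (rule idealI)
  show "subgroup {f \<in> carrier A. \<forall>p\<in>nf. f p = 0} (add_monoid A)"
  proof (rule A.add.subgroupI)
    fix f assume f: "f \<in> {f \<in> carrier A. \<forall>p\<in>nf. f p = 0}"
    have "f \<oplus>\<^bsub>A\<^esub> \<ominus>\<^bsub>A\<^esub> f = \<zero>\<^bsub>A\<^esub>" using f by (simp add: A.r_neg)
    then have "f p + (\<ominus>\<^bsub>A\<^esub> f) p = 0" for p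
      unfolding path_algebra_simps by (rule fun_cong)
    then show "\<ominus>\<^bsub>A\<^esub> f \<in> {f \<in> carrier A. \<forall>p\<in>nf. f p = 0}"
      using f by (auto dest: bspec) (metis add_0)
  next
    show "{f \<in> carrier A. \<forall>p\<in>nf. f p = 0} \<noteq> {}"
      using A.zero_closed by (auto simp: path_algebra_simps(3))
  qed (use A.a_closed in \<open>auto simp: path_algebra_simps(2)\<close>)
next
  fix a x assume a: "a \<in> {f \<in> carrier A. \<forall>p\<in>nf. f p = 0}" and x: "x \<in> carrier A"
  then have "x \<otimes>\<^bsub>A\<^esub> a \<in> carrier A" "a \<otimes>\<^bsub>A\<^esub> x \<in> carrier A" by auto
  moreover have "(x \<otimes>\<^bsub>A\<^esub> a) (u, w) = 0" "(a \<otimes>\<^bsub>A\<^esub> x) (u, w) = 0" if "(u, w) \<in> nf" for u w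
    using a nf_take[OF that] nf_drop[OF that] by (auto simp: path_algebra_mult)
  ultimately show "x \<otimes>\<^bsub>A\<^esub> a \<in> {f \<in> carrier A. \<forall>p\<in>nf. f p = 0}"
    "a \<otimes>\<^bsub>A\<^esub> x \<in> {f \<in> carrier A. \<forall>p\<in>nf. f p = 0}" by auto
qed (rule A.ring_axioms)

lemma path_elem_in_I:
  assumes "p \<in> paths Q" "p \<notin> nf"
  shows "path_elem p \<in> I"
proof -
  obtain u w where p: "p = (u, w)" by fastforce
  with assms have "\<not> successively (\<lambda>a b. (tail Q a, [a, b]) \<notin> R) w" by (simp add: nf_def)
  then obtain ys a b zs where w: "w = ys @ [a, b] @ zs" and ab: "(tail Q a, [a, b]) \<in> R"
    using not_successively_split by blast
  let ?ys = "path_elem (u, ys)" and ?ab = "path_elem (tail Q a, [a, b])"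
    and ?zs = "path_elem (head Q b, zs)"
  have paths: "(u, ys) \<in> paths Q" "(awlast u ys, [a, b]) \<in> paths Q" "(head Q b, zs) \<in> paths Q"
    using assms(1) by (auto simp: p w paths_append awalk_verts_conv[of _ "_ # _"] awlast_append simp del: append.simps)
  moreover have "awlast u ys = tail Q a"
    using paths(2) by (auto simp: path_iff awalk_simps)
  ultimately have "path_elem p = ?zs \<otimes>\<^bsub>A\<^esub> (?ab \<otimes>\<^bsub>A\<^esub> ?ys)"
    by (simp add: path_elem_mult awalk_verts_conv p w)
  moreover have "?ab \<in> I"
    unfolding I_def using A.genideal_self[of "path_elem ` R"] ab relations
    by (auto intro: path_elem_carrier)
  ultimately show ?thesis
    using paths by (simp add: I.I_l_closed I.I_r_closed path_elem_carrier)
qed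

text \<open>An ideal of a ring is closed under scalars \<open>c \<in> k\<close> because \<open>c e\<^sub>u\<close> is an element of the path algebra.\<close>

lemma scaled_path_elem_in_I:
  assumes "p \<in> paths Q" "p \<notin> nf"
  shows "(\<lambda>q. c * path_elem p q) \<in> I"
proof -
  obtain u w where p: "p = (u, w)" by fastforce
  define e :: "('v, 'a) path \<Rightarrow> 'k" where "e = (\<lambda>q. c * path_elem (u, []) q)"
  have "u \<in> verts Q" using assms(1) by (auto simp: p path_iff awalk_hd_in_verts)
  then have "e \<in> carrier A"
    by (auto simp: e_def path_algebra_simps path_elem_def split: if_splits)
  moreover have "path_elem p \<otimes>\<^bsub>A\<^esub> e = (\<lambda>q. c * path_elem p q)"
  proof
    fix x :: "('v, 'a) path"
    obtain u' w' where x: "x = (u', w')" by fastforce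
    have "(path_elem p \<otimes>\<^bsub>A\<^esub> e) x = c * (path_elem p \<otimes>\<^bsub>A\<^esub> path_elem (u, [])) x"
      by (simp add: x path_algebra_mult e_def sum_distrib_left mult.left_commute)
    also have "path_elem p \<otimes>\<^bsub>A\<^esub> path_elem (u, []) = path_elem p"
      by (simp add: p path_elem_mult)
    finally show "(path_elem p \<otimes>\<^bsub>A\<^esub> e) x = c * path_elem p x" .
  qed
  ultimately show ?thesis
    using I.I_r_closed[OF path_elem_in_I[OF assms]] by metis
qed

text \<open>
  The right-hand side is an ideal that contains the relations. Conversely, a path that runs through a
  relation \<open>r\<close> is a product \<open>q r p\<close> and so lies in \<open>I\<close>.
\<close>

lemma I_eq: "I = {f \<in> carrier A. \<forall>p\<in>nf. f p = 0}"
proof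
  have "(path_elem (u, w) :: ('v, 'a) path \<Rightarrow> 'k) p = 0" if "(u, w) \<in> R" "p \<in> nf" for u w p
  proof -
    obtain a b where "w = [a, b]" using relations \<open>(u, w) \<in> R\<close>
      by (auto simp: length_Suc_conv numeral_2_eq_2)
    moreover have "(u, w) \<in> paths Q" using relations \<open>(u, w) \<in> R\<close> by auto
    ultimately have "(u, w) \<notin> nf" using \<open>(u, w) \<in> R\<close>
      by (auto simp: nf_def path_iff awalk_simps)
    then show ?thesis using \<open>p \<in> nf\<close> by (auto simp: path_elem_def)
  qed
  then have "path_elem ` R \<subseteq> {f \<in> carrier A. \<forall>p\<in>nf. f p = 0}"
    using relations by (auto intro: path_elem_carrier)
  then show "I \<subseteq> {f \<in> carrier A. \<forall>p\<in>nf. f p = 0}"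
    unfolding I_def by (intro A.genideal_minimal ideal_zero_on_nf)
next
  have *: "f \<in> I" if "finite S" "{p. f p \<noteq> 0} = S" "S \<subseteq> paths Q - nf" for f S
    using that
  proof (induction S arbitrary: f)
    case empty
    then have "f = (\<lambda>_. 0)" by (intro ext) blast
    then have "f = \<zero>\<^bsub>A\<^esub>" by (simp only: path_algebra_simps(3))
    then show ?case using I.zero_closed by (simp only:)
  next
    case (insert p S)
    have supp: "{q. (f(p := 0)) q \<noteq> 0} = S" using insert.hyps insert.prems(1) by auto
    have "f(p := 0) \<in> I" using insert.prems(2) by (intro insert.IH supp) auto
    moreover have "(\<lambda>q. f p * path_elem p q) \<in> I"
      using insert.prems(2) by (intro scaled_path_elem_in_I) auto
    ultimately have "f(p := 0) \<oplus>\<^bsub>A\<^esub> (\<lambda>q. f p * path_elem p q) \<in> I" by (rule I.a_closed)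
    moreover have "f(p := 0) \<oplus>\<^bsub>A\<^esub> (\<lambda>q. f p * path_elem p q) = f"
      by (auto simp: path_algebra_simps(2) path_elem_def)
    ultimately show ?case by simp
  qed
  show "{f \<in> carrier A. \<forall>p\<in>nf. f p = 0} \<subseteq> I"
  proof
    fix f assume "f \<in> {f \<in> carrier A. \<forall>p\<in>nf. f p = 0}"
    then have "finite {p. f p \<noteq> 0}" "{p. f p \<noteq> 0} \<subseteq> paths Q - nf"
      unfolding path_algebra_simps by auto
    then show "f \<in> I" by (rule *[OF _ refl])
  qed
qed

text \<open>
  The paths without relations thus give a basis of \<open>\<Lambda>\<close>; \<open>coeff X p\<close> is the coefficient of \<open>X\<close> at the basis
  element \<open>p\<close>, read off from any representative of the coset, and \<open>0\<close> at the other paths.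
\<close>

definition coeff :: "('v, 'a, 'k) quot \<Rightarrow> ('v, 'a) path \<Rightarrow> 'k" where
  "coeff X p = (if p \<in> nf then (SOME f. f \<in> X) p else 0)"

lemma mem_coset: "g \<in> coset Q I f \<longleftrightarrow> (\<exists>h\<in>I. g = (\<lambda>p. h p + f p))"
  by (auto simp: coset_def a_r_coset_def' path_algebra_simps)

lemma self_in_coset: "f \<in> coset Q I f"
proof -
  have "(\<lambda>_. 0) \<in> I" using I.zero_closed by (simp only: path_algebra_simps(3))
  then show ?thesis unfolding mem_coset by (intro bexI[of _ "\<lambda>_. 0"]) simp_all
qed

lemma coeff_coset: "coeff (coset Q I f) p = (if p \<in> nf then f p else 0)"
proof (cases "p \<in> nf")
  case True
  define g where "g = (SOME g. g \<in> coset Q I f)"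
  have "g \<in> coset Q I f"
    unfolding g_def using self_in_coset by (rule someI[where P = "\<lambda>g. g \<in> coset Q I f"])
  then obtain h where "h \<in> I" and g: "g = (\<lambda>p. h p + f p)"
    by (rule bexE[OF iffD1[OF mem_coset]])
  from \<open>h \<in> I\<close> have "h p = 0" using True unfolding I_eq by simp
  then have "g p = f p" unfolding g by simp
  then show ?thesis using True by (simp only: coeff_def g_def if_True)
qed (simp add: coeff_def)

lemma coset_eq:
  assumes "f \<in> carrier A" "g \<in> carrier A" "\<And>p. p \<in> nf \<Longrightarrow> f p = g p"
  shows "coset Q I f = coset Q I g"
proof -
  have "f \<ominus>\<^bsub>A\<^esub> g \<in> carrier A" using assms by simp
  moreover have "(f \<ominus>\<^bsub>A\<^esub> g) p = f p - g p" for p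
  proof -
    have "(f \<ominus>\<^bsub>A\<^esub> g) \<oplus>\<^bsub>A\<^esub> g = f" using assms by (simp add: A.minus_eq A.a_assoc A.l_neg)
    then have "(f \<ominus>\<^bsub>A\<^esub> g) p + g p = f p"
      unfolding path_algebra_simps by (rule fun_cong)
    then show ?thesis by (simp add: eq_diff_eq)
  qed
  ultimately have "f \<ominus>\<^bsub>A\<^esub> g \<in> I" unfolding I_eq using assms(3) by auto
  then show ?thesis
    unfolding coset_def using A.quotient_eq_iff_same_a_r_cos[OF ideal_I assms(1,2)] by (rule iffD1[rotated])
qed

lemma carrier_L: "carrier L = coset Q I ` carrier A"
  by (auto simp: quiver_algebra_def FactRing_def A_RCOSETS_defs coset_def a_r_coset_def)

lemma coset_carrier [intro]: "f \<in> carrier A \<Longrightarrow> coset Q I f \<in> carrier L"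
  by (simp add: carrier_L)

lemma coeff_outside [simp]: "p \<notin> nf \<Longrightarrow> coeff X p = 0"
  by (simp add: coeff_def)

lemma finite_coeff: "X \<in> carrier L \<Longrightarrow> finite {p. coeff X p \<noteq> 0}"
  by (auto simp: carrier_L coeff_coset path_algebra_simps elim!: rev_finite_subset)

lemma coeff_eqI:
  assumes "X \<in> carrier L" "Y \<in> carrier L" "\<And>p. p \<in> nf \<Longrightarrow> coeff X p = coeff Y p"
  shows "X = Y"
proof -
  obtain f g where fg: "f \<in> carrier A" "X = coset Q I f" "g \<in> carrier A" "Y = coset Q I g"
    using assms by (auto simp: carrier_L)
  have "f p = g p" if "p \<in> nf" for p
    using assms(3)[OF that] that by (simp add: fg coeff_coset)
  then show ?thesis unfolding fg using fg by (intro coset_eq)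
qed

lemma coset_add:
  "f \<in> carrier A \<Longrightarrow> g \<in> carrier A \<Longrightarrow> coset Q I f \<oplus>\<^bsub>L\<^esub> coset Q I g = coset Q I (f \<oplus>\<^bsub>A\<^esub> g)"
  by (simp add: quiver_algebra_def FactRing_def coset_def I.a_rcos_sum)

lemma coset_mult:
  "f \<in> carrier A \<Longrightarrow> g \<in> carrier A \<Longrightarrow> coset Q I f \<otimes>\<^bsub>L\<^esub> coset Q I g = coset Q I (f \<otimes>\<^bsub>A\<^esub> g)"
  by (simp add: quiver_algebra_def FactRing_def coset_def I.rcoset_mult_add)

lemma coeff_zero [simp]: "coeff \<zero>\<^bsub>L\<^esub> p = 0"
proof -
  have "\<zero>\<^bsub>L\<^esub> = coset Q I \<zero>\<^bsub>A\<^esub>"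
    by (simp add: quiver_algebra_def FactRing_def coset_def A.a_rcos_zero[OF ideal_I])
  then show ?thesis by (simp add: coeff_coset path_algebra_simps)
qed

lemma coeff_add:
  "X \<in> carrier L \<Longrightarrow> Y \<in> carrier L \<Longrightarrow> coeff (X \<oplus>\<^bsub>L\<^esub> Y) p = coeff X p + coeff Y p"
  by (auto simp: carrier_L coset_add coeff_coset path_algebra_simps(2))

lemma coeff_mult:
  assumes "X \<in> carrier L" "Y \<in> carrier L" "(u, w) \<in> nf"
  shows "coeff (X \<otimes>\<^bsub>L\<^esub> Y) (u, w) =
    (\<Sum>i\<le>length w. coeff X (awlast u (take i w), drop i w) * coeff Y (u, take i w))"
  using assms nf_take[OF assms(3)] nf_drop[OF assms(3)]
  by (auto simp: carrier_L coset_mult coeff_coset path_algebra_mult)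

lemma coeff_finsum:
  assumes "finite S" "\<And>s. s \<in> S \<Longrightarrow> F s \<in> carrier L"
  shows "coeff (finsum L F S) p = (\<Sum>s\<in>S. coeff (F s) p)"
  using assms
proof (induction S)
  case (insert s S)
  then have "finsum L F S \<in> carrier L" by (intro L.finsum_closed) auto
  with insert show ?case by (simp add: L.finsum_insert Pi_def coeff_add)
qed simp

lemma ex_coeff:
  assumes "finite {p. \<phi> p \<noteq> 0}" "\<And>p. p \<notin> nf \<Longrightarrow> \<phi> p = 0"
  shows "coset Q I \<phi> \<in> carrier L" "coeff (coset Q I \<phi>) = \<phi>"
proof -
  have "\<phi> \<in> carrier A" using assms nf_paths by (auto simp: path_algebra_simps)
  then show "coset Q I \<phi> \<in> carrier L" by (rule coset_carrier)
  show "coeff (coset Q I \<phi>) = \<phi>" using assms(2) by (auto simp: coeff_coset)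
qed

lemma idem:
  assumes "x \<in> verts Q"
  shows "idem Q I x \<in> carrier L" "coeff (idem Q I x) p = (if p = (x, []) then 1 else 0)"
  using assms
  by (simp_all add: idem_def path_elem_carrier coset_carrier) (simp add: coeff_coset path_elem_def)

lemma coeff_mult_idem:
  assumes "X \<in> carrier L" "x \<in> verts Q"
  shows "coeff (X \<otimes>\<^bsub>L\<^esub> idem Q I x) (u, w) = (if u = x then coeff X (u, w) else 0)"
proof (cases "(u, w) \<in> nf")
  case True
  have "coeff (X \<otimes>\<^bsub>L\<^esub> idem Q I x) (u, w) =
      (\<Sum>i\<le>length w. if i = 0 then (if u = x then coeff X (u, w) else 0) else 0)"
    unfolding coeff_mult[OF assms(1) idem(1)[OF assms(2)] True] using assms(2)
    by (intro sum.cong refl) (auto simp: idem)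
  then show ?thesis by simp
qed auto

lemma proj_iff:
  assumes "x \<in> verts Q"
  shows "X \<in> proj Q I x \<longleftrightarrow> X \<in> carrier L \<and> (\<forall>u w. coeff X (u, w) \<noteq> 0 \<longrightarrow> u = x)"
proof
  assume "X \<in> proj Q I x"
  then show "X \<in> carrier L \<and> (\<forall>u w. coeff X (u, w) \<noteq> 0 \<longrightarrow> u = x)"
    using assms by (auto simp: proj_def coeff_mult_idem idem split: if_splits)
next
  assume X: "X \<in> carrier L \<and> (\<forall>u w. coeff X (u, w) \<noteq> 0 \<longrightarrow> u = x)"
  then have "X = X \<otimes>\<^bsub>L\<^esub> idem Q I x"
    using assms by (intro coeff_eqI) (simp_all add: coeff_mult_idem idem split_paired_all, blast)
  then show "X \<in> proj Q I x" using X by (auto simp: proj_def)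
qed

lemma arrow_ideal_coeff:
  assumes "X \<in> arrow_ideal Q I"
  shows "coeff X (u, []) = 0"
proof -
  obtain f where "X = coset Q I f" "\<forall>p. f p \<noteq> 0 \<longrightarrow> 1 \<le> length (snd p)"
    using assms by (auto simp: arrow_ideal_def)
  then have "f (u, []) = 0" by (metis list.size(3) not_one_le_zero snd_conv)
  with \<open>X = coset Q I f\<close> show ?thesis by (simp add: coeff_coset)
qed

text \<open>\<open>I\<close> is homogeneous: cutting an element of \<open>I\<close> down to one length leaves it in \<open>I\<close>.\<close>

lemma length_part:
  assumes "X \<in> carrier L"
  shows "length_part Q I j X \<in> carrier L"
    "coeff (length_part Q I j X) p = (if length (snd p) = j then coeff X p else 0)"
proof -
  let ?t = "\<lambda>f p. if length (snd p) = j then f p else (0::'k)"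
  obtain f where f: "f \<in> carrier A" "X = coset Q I f" using assms by (auto simp: carrier_L)
  have t: "?t g \<in> carrier A" if "g \<in> carrier A" for g
  proof -
    have "{p. ?t g p \<noteq> 0} \<subseteq> {p. g p \<noteq> 0}" by auto
    with that show ?thesis unfolding path_algebra_simps by (blast intro: finite_subset)
  qed
  have mem: "g \<in> length_part Q I j X \<longleftrightarrow> (\<exists>h\<in>I. \<exists>f'\<in>X. g = (\<lambda>p. h p + ?t f' p))" for g
    by (simp add: length_part_def set_add_def' path_algebra_simps(2))
  have "length_part Q I j X = coset Q I (?t f)"
  proof
    show "length_part Q I j X \<subseteq> coset Q I (?t f)"
    proof
      fix g assume "g \<in> length_part Q I j X"
      then obtain h f' where h: "h \<in> I" and f': "f' \<in> X" and g: "g = (\<lambda>p. h p + ?t f' p)"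
        unfolding mem by (elim bexE)
      obtain h' where h': "h' \<in> I" and f'_eq: "f' = (\<lambda>p. h' p + f p)"
        by (rule bexE[OF iffD1[OF mem_coset f'[unfolded f(2)]]])
      have "?t h' \<in> I" using h' t[of h'] unfolding I_eq by simp
      with h have "h \<oplus>\<^bsub>A\<^esub> ?t h' \<in> I" by (rule I.a_closed)
      moreover have "g = (\<lambda>p. (h \<oplus>\<^bsub>A\<^esub> ?t h') p + ?t f p)"
        unfolding g f'_eq path_algebra_simps(2) by (intro ext) simp
      ultimately show "g \<in> coset Q I (?t f)"
        by (rule iffD2[OF mem_coset, OF bexI[where x = "h \<oplus>\<^bsub>A\<^esub> ?t h'"], rotated])
    qed
    show "coset Q I (?t f) \<subseteq> length_part Q I j X"
    proof
      fix g assume "g \<in> coset Q I (?t f)"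
      then obtain h where "h \<in> I" and g: "g = (\<lambda>p. h p + ?t f p)"
        by (rule bexE[OF iffD1[OF mem_coset]])
      have "f \<in> X" unfolding f(2) by (rule self_in_coset)
      with \<open>h \<in> I\<close> show "g \<in> length_part Q I j X"
        unfolding mem g by (intro bexI[of _ h] bexI[of _ f] refl)
    qed
  qed
  then show "length_part Q I j X \<in> carrier L"
    "coeff (length_part Q I j X) p = (if length (snd p) = j then coeff X p else 0)"
    using f t by (auto simp: coeff_coset)
qed

abbreviation arrow :: "'a \<Rightarrow> ('v, 'a, 'k) quot" where
  "arrow a \<equiv> coset Q I (path_elem (tail Q a, [a]))"

lemma arrow_closed: "a \<in> arcs Q \<Longrightarrow> arrow a \<in> carrier L"
  using nf_paths nf_single[of "tail Q a" a] by (intro coset_carrier path_elem_carrier) auto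

text \<open>Left multiplication by an arrow appends it to the paths, so no two paths become equal.\<close>

lemma coeff_arrow_mult:
  assumes a: "a \<in> arcs Q" and X: "X \<in> carrier L" and w: "(u, w) \<in> nf"
  shows "coeff (arrow a \<otimes>\<^bsub>L\<^esub> X) (u, w) =
    (if w \<noteq> [] \<and> last w = a then coeff X (u, butlast w) else 0)"
proof -
  note \<alpha> = arrow_closed[OF a]
  have \<alpha>c: "coeff (arrow a) p = (if p = (tail Q a, [a]) then 1 else 0)" for p
    using a by (simp add: coeff_coset path_elem_def nf_single)
  show ?thesis
  proof (cases w rule: rev_cases)
    case Nil
    then show ?thesis by (simp add: coeff_mult[OF \<alpha> X w[unfolded Nil]] \<alpha>c Nil)
  next
    case (snoc v b)
    have "(awlast u v, [b]) \<in> nf" using w by (simp add: snoc nf_append)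
    then have v: "awlast u v = tail Q b" by (simp add: nf_single)
    have "coeff (arrow a \<otimes>\<^bsub>L\<^esub> X) (u, w) =
        (\<Sum>i\<le>length w. if i = length v then (if b = a then coeff X (u, v) else 0) else 0)"
      unfolding coeff_mult[OF \<alpha> X w]
    proof (intro sum.cong refl)
      fix i assume i: "i \<in> {..length w}"
      have "i = length v" if "drop i w = [a]"
        using arg_cong[OF that, of length] i by (simp add: snoc)
      then show "coeff (arrow a) (awlast u (take i w), drop i w) * coeff X (u, take i w) =
          (if i = length v then if b = a then coeff X (u, v) else 0 else 0)"
        by (cases "i = length v") (auto simp: \<alpha>c snoc v)
    qed
    then show ?thesis by (simp add: snoc)
  qed
qed

section \<open>Maps between direct sums of projectives\<close>

abbreviation P :: "'v gens \<Rightarrow> (('v, 'a, 'k) quot, nat \<Rightarrow> ('v, 'a, 'k) quot) gmodule" where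
  "P G \<equiv> proj_sum Q I G"

lemma proj_sum_simps:
  "\<zero>\<^bsub>P G\<^esub> = (\<lambda>_. \<zero>\<^bsub>L\<^esub>)"
  "f \<oplus>\<^bsub>P G\<^esub> g = (\<lambda>b. f b \<oplus>\<^bsub>L\<^esub> g b)"
  "r \<odot>\<^bsub>P G\<^esub> f = (\<lambda>b. r \<otimes>\<^bsub>L\<^esub> f b)"
  by (simp_all add: proj_sum_def Let_def)

lemma proj_sum_iff:
  assumes "fst ` ran G \<subseteq> verts Q"
  shows "f \<in> carrier (P G) \<longleftrightarrow> finite {b. f b \<noteq> \<zero>\<^bsub>L\<^esub>} \<and> (\<forall>b. f b \<in> carrier L) \<and>
    (\<forall>b u w. coeff (f b) (u, w) \<noteq> 0 \<longrightarrow> (\<exists>i. G b = Some (u, i)))"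
proof -
  have *: "(case G b of None \<Rightarrow> f b = \<zero>\<^bsub>L\<^esub> | Some (x, i) \<Rightarrow> f b \<in> proj Q I x) \<longleftrightarrow>
      f b \<in> carrier L \<and> (\<forall>u w. coeff (f b) (u, w) \<noteq> 0 \<longrightarrow> (\<exists>i. G b = Some (u, i)))" for b
  proof (cases "G b")
    case None
    have "f b = \<zero>\<^bsub>L\<^esub>" if "f b \<in> carrier L" "\<forall>u w. coeff (f b) (u, w) = 0"
      using that by (intro coeff_eqI) (simp_all add: split_paired_all)
    then have "f b = \<zero>\<^bsub>L\<^esub> \<longleftrightarrow> f b \<in> carrier L \<and> (\<forall>u w. coeff (f b) (u, w) = 0)"
      by (metis L.zero_closed coeff_zero)
    then show ?thesis by (simp only: None option.case) simp
  next
    case (Some xi)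
    obtain x i where xi: "xi = (x, i)" by fastforce
    have "x \<in> verts Q" using assms Some xi by (force intro: ranI)
    with Some xi show ?thesis by (auto simp: proj_iff)
  qed
  have "f \<in> carrier (P G) \<longleftrightarrow> finite {b. f b \<noteq> \<zero>\<^bsub>L\<^esub>} \<and>
      (\<forall>b. case G b of None \<Rightarrow> f b = \<zero>\<^bsub>L\<^esub> | Some (x, i) \<Rightarrow> f b \<in> proj Q I x)"
    by (simp add: proj_sum_def Let_def)
  then show ?thesis unfolding * by blast
qed

lemma proj_sum_coord [intro]: "fst ` ran G \<subseteq> verts Q \<Longrightarrow> f \<in> carrier (P G) \<Longrightarrow> f b \<in> carrier L"
  by (simp add: proj_sum_iff)

lemma proj_sum_start:
  assumes "fst ` ran G \<subseteq> verts Q" "f \<in> carrier (P G)" "coeff (f b) (u, w) \<noteq> 0"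
  shows "\<exists>i. G b = Some (u, i)"
  using assms(2,3) unfolding proj_sum_iff[OF assms(1)] by blast

lemma proj_sum_eqI:
  assumes "\<And>b. f b \<in> carrier L" "\<And>b. g b \<in> carrier L"
    "\<And>b u w. (u, w) \<in> nf \<Longrightarrow> coeff (f b) (u, w) = coeff (g b) (u, w)"
  shows "f = g"
  using assms by (intro ext coeff_eqI) auto

lemma ex_proj_sum:
  assumes G: "fst ` ran G \<subseteq> verts Q"
    and nf: "\<And>b p. \<phi> b p \<noteq> 0 \<Longrightarrow> p \<in> nf"
    and start: "\<And>b u w. \<phi> b (u, w) \<noteq> 0 \<Longrightarrow> \<exists>i. G b = Some (u, i)"
    and fin: "\<And>b. finite {p. \<phi> b p \<noteq> 0}"
    and supp: "finite S" "\<And>b p. \<phi> b p \<noteq> 0 \<Longrightarrow> b \<in> S"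
  shows "(\<lambda>b. coset Q I (\<phi> b)) \<in> carrier (P G)" "coeff (coset Q I (\<phi> b)) = \<phi> b"
proof -
  have *: "coset Q I (\<phi> b) \<in> carrier L" "coeff (coset Q I (\<phi> b)) = \<phi> b" for b
    using ex_coeff[OF fin[of b]] nf by blast+
  then show "coeff (coset Q I (\<phi> b)) = \<phi> b" by blast
  have "coset Q I (\<phi> b) = \<zero>\<^bsub>L\<^esub>" if "b \<notin> S" for b
    using * supp(2)[of b] that by (intro coeff_eqI) auto
  then have "{b. coset Q I (\<phi> b) \<noteq> \<zero>\<^bsub>L\<^esub>} \<subseteq> S" by blast
  then show "(\<lambda>b. coset Q I (\<phi> b)) \<in> carrier (P G)"
    using * start supp(1) by (auto simp: proj_sum_iff[OF G] intro: finite_subset)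
qed

lemma finite_supp: "f \<in> carrier (P G) \<Longrightarrow> finite {b. f b \<noteq> \<zero>\<^bsub>L\<^esub>}"
  by (auto simp: proj_sum_def Let_def)

lemma proj_sum_zero: "fst ` ran G \<subseteq> verts Q \<Longrightarrow> \<zero>\<^bsub>P G\<^esub> \<in> carrier (P G)"
  by (simp add: proj_sum_iff proj_sum_simps)

lemma proj_sum_add:
  assumes G: "fst ` ran G \<subseteq> verts Q" and f: "f \<in> carrier (P G)" and g: "g \<in> carrier (P G)"
  shows "f \<oplus>\<^bsub>P G\<^esub> g \<in> carrier (P G)"
proof -
  have "{b. f b \<oplus>\<^bsub>L\<^esub> g b \<noteq> \<zero>\<^bsub>L\<^esub>} \<subseteq> {b. f b \<noteq> \<zero>\<^bsub>L\<^esub>} \<union> {b. g b \<noteq> \<zero>\<^bsub>L\<^esub>}" by auto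
  moreover have "finite ({b. f b \<noteq> \<zero>\<^bsub>L\<^esub>} \<union> {b. g b \<noteq> \<zero>\<^bsub>L\<^esub>})"
    using f g by (simp add: finite_supp)
  ultimately have "finite {b. f b \<oplus>\<^bsub>L\<^esub> g b \<noteq> \<zero>\<^bsub>L\<^esub>}" by (rule finite_subset)
  moreover have "\<exists>i. G b = Some (u, i)" if "coeff (f b \<oplus>\<^bsub>L\<^esub> g b) (u, w) \<noteq> 0" for b u w
  proof -
    have "coeff (f b) (u, w) \<noteq> 0 \<or> coeff (g b) (u, w) \<noteq> 0"
      using that f g by (auto simp: coeff_add proj_sum_iff[OF G])
    then show ?thesis using proj_sum_start[OF G] f g by blast
  qed
  ultimately show ?thesis using f g by (simp add: proj_sum_iff[OF G] proj_sum_simps)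
qed

lemma proj_sum_smult:
  assumes G: "fst ` ran G \<subseteq> verts Q" and f: "f \<in> carrier (P G)" and r: "r \<in> carrier L"
  shows "r \<odot>\<^bsub>P G\<^esub> f \<in> carrier (P G)"
proof -
  have "r \<otimes>\<^bsub>L\<^esub> f b = \<zero>\<^bsub>L\<^esub>" if "f b = \<zero>\<^bsub>L\<^esub>" for b using r that by simp
  then have "{b. r \<otimes>\<^bsub>L\<^esub> f b \<noteq> \<zero>\<^bsub>L\<^esub>} \<subseteq> {b. f b \<noteq> \<zero>\<^bsub>L\<^esub>}" by blast
  then have "finite {b. r \<otimes>\<^bsub>L\<^esub> f b \<noteq> \<zero>\<^bsub>L\<^esub>}" using finite_supp[OF f] by (rule finite_subset)
  moreover have "\<exists>i. G b = Some (u, i)" if nz: "coeff (r \<otimes>\<^bsub>L\<^esub> f b) (u, w) \<noteq> 0" for b u w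
  proof -
    have fb: "f b \<in> carrier L" using f by (auto simp: proj_sum_iff[OF G])
    have "(u, w) \<in> nf" using nz coeff_outside by blast
    then obtain i where "coeff (f b) (u, take i w) \<noteq> 0"
      using nz unfolding coeff_mult[OF r fb \<open>(u, w) \<in> nf\<close>]
      by (metis (no_types, lifting) mult_zero_right sum.neutral)
    then show ?thesis using proj_sum_start[OF G f] by blast
  qed
  ultimately show ?thesis using f r by (simp add: proj_sum_iff[OF G] proj_sum_simps)
qed

lemma ex_proj_sum_diff:
  assumes G: "fst ` ran G \<subseteq> verts Q" and f: "f \<in> carrier (P G)" and g: "g \<in> carrier (P G)"
  obtains h where "h \<in> carrier (P G)" "f = h \<oplus>\<^bsub>P G\<^esub> g"
    "\<And>b p. coeff (h b) p = coeff (f b) p - coeff (g b) p"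
proof -
  let ?\<phi> = "\<lambda>b p. coeff (f b) p - coeff (g b) p"
  have fin: "finite {p. ?\<phi> b p \<noteq> 0}" for b
  proof -
    have "{p. ?\<phi> b p \<noteq> 0} \<subseteq> {p. coeff (f b) p \<noteq> 0} \<union> {p. coeff (g b) p \<noteq> 0}" by auto
    then show ?thesis
      by (rule finite_subset)
        (intro finite_UnI finite_coeff proj_sum_coord[OF G f] proj_sum_coord[OF G g])
  qed
  have nz: "coeff (f b) p \<noteq> 0 \<or> coeff (g b) p \<noteq> 0" if "?\<phi> b p \<noteq> 0" for b p
    using that by auto
  have nf: "p \<in> nf" if "?\<phi> b p \<noteq> 0" for b p using nz[OF that] coeff_outside by blast
  have start: "\<exists>i. G b = Some (u, i)" if "?\<phi> b (u, w) \<noteq> 0" for b u w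
    using nz[OF that] proj_sum_start[OF G] f g by blast
  have supp: "b \<in> {b. f b \<noteq> \<zero>\<^bsub>L\<^esub>} \<union> {b. g b \<noteq> \<zero>\<^bsub>L\<^esub>}" if "?\<phi> b p \<noteq> 0" for b p
    using nz[OF that] by auto
  have S: "finite ({b. f b \<noteq> \<zero>\<^bsub>L\<^esub>} \<union> {b. g b \<noteq> \<zero>\<^bsub>L\<^esub>})" using f g by (simp add: finite_supp)
  define h where "h = (\<lambda>b. coset Q I (?\<phi> b))"
  have h: "h \<in> carrier (P G)" "\<And>b p. coeff (h b) p = ?\<phi> b p"
    unfolding h_def using ex_proj_sum[where \<phi> = ?\<phi>, OF G nf start fin S supp] by simp_all
  have "f = h \<oplus>\<^bsub>P G\<^esub> g"
    using G f g h by (intro proj_sum_eqI) (auto simp: proj_sum_simps coeff_add proj_sum_coord)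
  with h that show ?thesis by blast
qed

lemma gen_carrier:
  assumes G: "fst ` ran G \<subseteq> verts Q"
  shows "gen Q I G a \<in> carrier (P G)"
proof (cases "G a")
  case None
  then show ?thesis using G by (auto simp: gen_def proj_sum_iff)
next
  case (Some xi)
  obtain x i where xi: "xi = (x, i)" by fastforce
  have x: "x \<in> verts Q" using G Some xi by (force intro: ranI)
  have "{b. (if b = a then idem Q I x else \<zero>\<^bsub>L\<^esub>) \<noteq> \<zero>\<^bsub>L\<^esub>} \<subseteq> {a}" by auto
  then have "finite {b. (if b = a then idem Q I x else \<zero>\<^bsub>L\<^esub>) \<noteq> \<zero>\<^bsub>L\<^esub>}"
    by (rule finite_subset) simp
  then show ?thesis
    using G x Some xi by (auto simp: gen_def proj_sum_iff idem split: if_splits)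
qed

lemma graded_homD:
  assumes "graded_hom Q I M N d"
  shows "m \<in> carrier M \<Longrightarrow> d m \<in> carrier N"
    "m \<in> carrier M \<Longrightarrow> m' \<in> carrier M \<Longrightarrow> d (m \<oplus>\<^bsub>M\<^esub> m') = d m \<oplus>\<^bsub>N\<^esub> d m'"
    "r \<in> carrier L \<Longrightarrow> m \<in> carrier M \<Longrightarrow> d (r \<odot>\<^bsub>M\<^esub> m) = r \<odot>\<^bsub>N\<^esub> d m"
  using assms by (auto simp: graded_hom_def)

context
  fixes G G' d
  assumes G: "fst ` ran G \<subseteq> verts Q" and G': "fst ` ran G' \<subseteq> verts Q"
    and d: "graded_hom Q I (P G) (P G') d"
begin

lemma hom_coord [simp]: "f \<in> carrier (P G) \<Longrightarrow> d f b \<in> carrier L"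
  using graded_homD(1)[OF d] G' by auto

lemma hom_zero: "d \<zero>\<^bsub>P G\<^esub> = \<zero>\<^bsub>P G'\<^esub>"
proof -
  have z: "\<zero>\<^bsub>P G\<^esub> \<in> carrier (P G)" using G by (rule proj_sum_zero)
  have "\<zero>\<^bsub>P G\<^esub> \<oplus>\<^bsub>P G\<^esub> \<zero>\<^bsub>P G\<^esub> = \<zero>\<^bsub>P G\<^esub>" by (simp add: proj_sum_simps)
  then have "d \<zero>\<^bsub>P G\<^esub> = d \<zero>\<^bsub>P G\<^esub> \<oplus>\<^bsub>P G'\<^esub> d \<zero>\<^bsub>P G\<^esub>"
    using graded_homD(2)[OF d z z] by simp
  then have "coeff (d \<zero>\<^bsub>P G\<^esub> b) p = coeff (d \<zero>\<^bsub>P G\<^esub> b) p + coeff (d \<zero>\<^bsub>P G\<^esub> b) p" for b p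
    using z by (metis coeff_add hom_coord proj_sum_simps(2))
  then have "coeff (d \<zero>\<^bsub>P G\<^esub> b) p = 0" for b p by (metis add_cancel_right_right)
  then show ?thesis using z
    by (intro proj_sum_eqI) (simp_all add: proj_sum_simps(1)[of G'])
qed

text \<open>
  Finite sums in \<open>P\<close> are expressed through coefficients, which turns them into sums in the field.
\<close>

lemma hom_sum:
  assumes "finite S" "\<And>s. s \<in> S \<Longrightarrow> g s \<in> carrier (P G)"
  shows "\<exists>f\<in>carrier (P G). (\<forall>b p. coeff (f b) p = (\<Sum>s\<in>S. coeff (g s b) p)) \<and>
    (\<forall>b p. coeff (d f b) p = (\<Sum>s\<in>S. coeff (d (g s) b) p))"
  using assms
proof (induction S)
  case empty
  show ?case using hom_zero proj_sum_zero[OF G]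
    by (intro bexI[of _ "\<zero>\<^bsub>P G\<^esub>"]) (auto simp: proj_sum_simps(1))
next
  case (insert s S)
  then obtain f where f: "f \<in> carrier (P G)" "\<And>b p. coeff (f b) p = (\<Sum>s\<in>S. coeff (g s b) p)"
    "\<And>b p. coeff (d f b) p = (\<Sum>s\<in>S. coeff (d (g s) b) p)" by (metis insertCI)
  have s: "g s \<in> carrier (P G)" using insert.prems by auto
  have sum: "d (g s \<oplus>\<^bsub>P G\<^esub> f) = d (g s) \<oplus>\<^bsub>P G'\<^esub> d f" using graded_homD(2)[OF d s f(1)] .
  have "coeff ((g s \<oplus>\<^bsub>P G\<^esub> f) b) p = (\<Sum>s\<in>insert s S. coeff (g s b) p)" for b p
    using s f insert.hyps G by (simp add: proj_sum_simps coeff_add proj_sum_coord)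
  moreover have "coeff (d (g s \<oplus>\<^bsub>P G\<^esub> f) b) p = (\<Sum>s\<in>insert s S. coeff (d (g s) b) p)" for b p
    using s f insert.hyps unfolding sum by (simp add: proj_sum_simps coeff_add)
  ultimately show ?case using proj_sum_add[OF G s f(1)] by blast
qed

lemma hom_sum_eq:
  assumes "finite S" "\<And>s. s \<in> S \<Longrightarrow> g s \<in> carrier (P G)" "f \<in> carrier (P G)"
    "\<And>b u w. (u, w) \<in> nf \<Longrightarrow> coeff (f b) (u, w) = (\<Sum>s\<in>S. coeff (g s b) (u, w))"
  shows "coeff (d f b) p = (\<Sum>s\<in>S. coeff (d (g s) b) p)"
proof -
  obtain f' where f': "f' \<in> carrier (P G)" "\<And>b p. coeff (f' b) p = (\<Sum>s\<in>S. coeff (g s b) p)"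
    "\<And>b p. coeff (d f' b) p = (\<Sum>s\<in>S. coeff (d (g s) b) p)"
    using hom_sum[where g = g, OF assms(1,2)] by blast
  have "f = f'" using assms(3,4) f'(1,2) G by (intro proj_sum_eqI) (auto simp: proj_sum_coord)
  then show ?thesis using f'(3) by simp
qed

text \<open>A homomorphism is right multiplication by the matrix of its values at the generators.\<close>

lemma coeff_hom:
  assumes f: "f \<in> carrier (P G)" and S: "finite S" "{a. f a \<noteq> \<zero>\<^bsub>L\<^esub>} \<subseteq> S" and w: "(u, w) \<in> nf"
  shows "coeff (d f b) (u, w) = (\<Sum>a\<in>S. \<Sum>i\<le>length w.
    coeff (f a) (awlast u (take i w), drop i w) * coeff (d (gen Q I G a) b) (u, take i w))"
proof -
  have fa: "f a \<in> carrier L" for a using f G by auto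
  have *: "f a \<otimes>\<^bsub>L\<^esub> gen Q I G a c = (if c = a then f a else \<zero>\<^bsub>L\<^esub>)" for a c
  proof (cases "G a")
    case None
    then have "f a = \<zero>\<^bsub>L\<^esub>"
      using proj_sum_start[OF G f, of a] fa by (intro coeff_eqI) (auto simp: None)
    with None show ?thesis by (simp add: gen_def)
  next
    case (Some xi)
    obtain x i where xi: "xi = (x, i)" by fastforce
    have x: "x \<in> verts Q" using G Some xi by (force intro: ranI)
    have "f a \<otimes>\<^bsub>L\<^esub> idem Q I x = f a"
    proof (rule coeff_eqI)
      fix p :: "('v, 'a) path"
      obtain u w where p: "p = (u, w)" by fastforce
      have "coeff (f a) (u, w) = 0" if "u \<noteq> x"
        using proj_sum_start[OF G f, of a u w] that Some xi by auto
      then show "coeff (f a \<otimes>\<^bsub>L\<^esub> idem Q I x) p = coeff (f a) p"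
        using x fa by (simp add: p coeff_mult_idem)
    qed (use x fa in \<open>auto simp: idem\<close>)
    with Some xi fa x show ?thesis by (simp add: gen_def)
  qed
  have "coeff (d f b) (u, w) = (\<Sum>a\<in>S. coeff (d (f a \<odot>\<^bsub>P G\<^esub> gen Q I G a) b) (u, w))"
  proof (rule hom_sum_eq)
    show "coeff (f c) (u', w') = (\<Sum>a\<in>S. coeff ((f a \<odot>\<^bsub>P G\<^esub> gen Q I G a) c) (u', w'))" for c u' w'
    proof -
      have "(\<Sum>a\<in>S. coeff ((f a \<odot>\<^bsub>P G\<^esub> gen Q I G a) c) (u', w')) =
          (\<Sum>a\<in>S. if a = c then coeff (f c) (u', w') else 0)"
        by (intro sum.cong refl) (auto simp: proj_sum_simps *)
      also have "\<dots> = coeff (f c) (u', w')"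
      proof -
        have "f c = \<zero>\<^bsub>L\<^esub>" if "c \<notin> S" using that S(2) by blast
        then show ?thesis using S(1) by (cases "c \<in> S") simp_all
      qed
      finally show ?thesis ..
    qed
  qed (use S(1) f fa G in \<open>auto intro: proj_sum_smult gen_carrier\<close>)
  also have "\<dots> = (\<Sum>a\<in>S. coeff (f a \<otimes>\<^bsub>L\<^esub> d (gen Q I G a) b) (u, w))"
    using graded_homD(3)[OF d fa gen_carrier[OF G]] by (simp add: proj_sum_simps)
  finally show ?thesis
    using w by (simp add: coeff_mult[OF fa hom_coord[OF gen_carrier[OF G]]])
qed

text \<open>
  In the linear part, only the factorization of \<open>w\<close> with an initial part of length \<open>1\<close> remains.
  The index set may be larger than the support of \<open>f\<close>, so that different elements can be compared.
\<close>

lemma linear_part: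
  assumes f: "f \<in> carrier (P G)"
  shows "map_part Q I G 1 d f b \<in> carrier L"
    "finite S \<Longrightarrow> {a. f a \<noteq> \<zero>\<^bsub>L\<^esub>} \<subseteq> S \<Longrightarrow> (u, w) \<in> nf \<Longrightarrow>
      coeff (map_part Q I G 1 d f b) (u, w) = (\<Sum>a\<in>S. if w = [] then 0 else
        coeff (f a) (awlast u (take 1 w), drop 1 w) * coeff (d (gen Q I G a) b) (u, take 1 w))"
proof -
  have fa: "f a \<in> carrier L" for a using f G by auto
  have part: "length_part Q I 1 (d (gen Q I G a) b) \<in> carrier L" for a
    using gen_carrier[OF G] by (intro length_part hom_coord)
  then show "map_part Q I G 1 d f b \<in> carrier L"
    using fa by (simp add: map_part_def Let_def L.finsum_closed)
  assume S: "finite S" "{a. f a \<noteq> \<zero>\<^bsub>L\<^esub>} \<subseteq> S" and w: "(u, w) \<in> nf"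
  have "coeff (map_part Q I G 1 d f b) (u, w) =
      (\<Sum>a | f a \<noteq> \<zero>\<^bsub>L\<^esub>. coeff (f a \<otimes>\<^bsub>L\<^esub> length_part Q I 1 (d (gen Q I G a) b)) (u, w))"
    unfolding map_part_def Let_def using finite_supp[OF f] fa part by (intro coeff_finsum) auto
  also have "\<dots> = (\<Sum>a\<in>S. coeff (f a \<otimes>\<^bsub>L\<^esub> length_part Q I 1 (d (gen Q I G a) b)) (u, w))"
    using S part by (intro sum.mono_neutral_left) auto
  also have "\<dots> = (\<Sum>a\<in>S. if w = [] then 0 else
      coeff (f a) (awlast u (take 1 w), drop 1 w) * coeff (d (gen Q I G a) b) (u, take 1 w))"
  proof (intro sum.cong refl)
    fix a
    have "coeff (f a \<otimes>\<^bsub>L\<^esub> length_part Q I 1 (d (gen Q I G a) b)) (u, w) =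
        (\<Sum>i\<le>length w. if i = 1 then coeff (f a) (awlast u (take 1 w), drop 1 w) *
          coeff (d (gen Q I G a) b) (u, take 1 w) else 0)"
      unfolding coeff_mult[OF fa part w] using gen_carrier[OF G]
      by (intro sum.cong refl) (auto simp: length_part(2) hom_coord)
    then show "coeff (f a \<otimes>\<^bsub>L\<^esub> length_part Q I 1 (d (gen Q I G a) b)) (u, w) =
      (if w = [] then 0 else
        coeff (f a) (awlast u (take 1 w), drop 1 w) * coeff (d (gen Q I G a) b) (u, take 1 w))"
      by (cases w) (auto simp: Suc_le_eq)
  qed
  finally show "coeff (map_part Q I G 1 d f b) (u, w) = (\<Sum>a\<in>S. if w = [] then 0 else
        coeff (f a) (awlast u (take 1 w), drop 1 w) * coeff (d (gen Q I G a) b) (u, take 1 w))" .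
qed

lemma linear_part_add:
  assumes f: "f \<in> carrier (P G)" and g: "g \<in> carrier (P G)"
  shows "map_part Q I G 1 d (f \<oplus>\<^bsub>P G\<^esub> g) = map_part Q I G 1 d f \<oplus>\<^bsub>P G'\<^esub> map_part Q I G 1 d g"
proof (rule proj_sum_eqI)
  fix b u w assume w: "(u, w) \<in> nf"
  define S where "S = {a. f a \<noteq> \<zero>\<^bsub>L\<^esub>} \<union> {a. g a \<noteq> \<zero>\<^bsub>L\<^esub>}"
  have S: "finite S" "{a. f a \<noteq> \<zero>\<^bsub>L\<^esub>} \<subseteq> S" "{a. g a \<noteq> \<zero>\<^bsub>L\<^esub>} \<subseteq> S"
    "{a. (f \<oplus>\<^bsub>P G\<^esub> g) a \<noteq> \<zero>\<^bsub>L\<^esub>} \<subseteq> S"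
    using f g by (auto simp: S_def finite_supp proj_sum_simps)
  have fg: "f a \<in> carrier L" "g a \<in> carrier L" for a using f g G by auto
  show "coeff (map_part Q I G 1 d (f \<oplus>\<^bsub>P G\<^esub> g) b) (u, w) =
      coeff ((map_part Q I G 1 d f \<oplus>\<^bsub>P G'\<^esub> map_part Q I G 1 d g) b) (u, w)"
    unfolding proj_sum_simps(2)[of G'] coeff_add[OF linear_part(1)[OF f] linear_part(1)[OF g]]
      linear_part(2)[OF f S(1,2) w] linear_part(2)[OF g S(1,3) w]
      linear_part(2)[OF proj_sum_add[OF G f g] S(1,4) w]
    using fg by (auto simp: proj_sum_simps coeff_add sum.distrib[symmetric] distrib_right
        intro!: sum.cong)
next
  show "map_part Q I G 1 d (f \<oplus>\<^bsub>P G\<^esub> g) b \<in> carrier L" for b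
    by (rule linear_part(1)[OF proj_sum_add[OF G f g]])
  show "(map_part Q I G 1 d f \<oplus>\<^bsub>P G'\<^esub> map_part Q I G 1 d g) b \<in> carrier L" for b
    unfolding proj_sum_simps(2)[of G'] by (intro L.a_closed linear_part(1) f g)
qed

end

section \<open>Stripping the last arrow\<close>

text \<open>\<open>lengths_ge j f\<close> says that \<open>f\<close> lies in \<open>J\<^sup>j P\<close>, where \<open>J\<close> is the arrow ideal.\<close>

definition lengths_ge :: "nat \<Rightarrow> (nat \<Rightarrow> ('v, 'a, 'k) quot) \<Rightarrow> bool" where
  "lengths_ge j f \<longleftrightarrow> (\<forall>b u w. length w < j \<longrightarrow> coeff (f b) (u, w) = 0)"

lemma lengths_geD: "lengths_ge j f \<Longrightarrow> length w < j \<Longrightarrow> coeff (f b) (u, w) = 0"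
  unfolding lengths_ge_def by blast

text \<open>The element \<open>f\<^sub>a\<close> of the decomposition \<open>f = \<Sum>\<^sub>a a f\<^sub>a\<close> by last arrows, available for \<open>f \<in> J P\<close>.\<close>

definition strip :: "'a \<Rightarrow> (nat \<Rightarrow> ('v, 'a, 'k) quot) \<Rightarrow> nat \<Rightarrow> ('v, 'a, 'k) quot" where
  "strip a f b = coset Q I (\<lambda>(u, w). coeff (f b) (u, w @ [a]))"

lemma strip:
  assumes G: "fst ` ran G \<subseteq> verts Q" and f: "f \<in> carrier (P G)"
  shows "strip a f \<in> carrier (P G)" "coeff (strip a f b) (u, w) = coeff (f b) (u, w @ [a])"
proof -
  let ?\<phi> = "\<lambda>b (u, w). coeff (f b) (u, w @ [a])"
  have nf: "p \<in> nf" if "?\<phi> b p \<noteq> 0" for b p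
  proof -
    obtain u w where p: "p = (u, w)" by fastforce
    with that have "coeff (f b) (u, w @ [a]) \<noteq> 0" by simp
    then have "(u, w @ [a]) \<in> nf" using coeff_outside by blast
    then show ?thesis by (simp add: p nf_append)
  qed
  have start: "\<exists>i. G b = Some (u, i)" if "?\<phi> b (u, w) \<noteq> 0" for b u w
    using that proj_sum_start[OF G f] by auto
  have fin: "finite {p. ?\<phi> b p \<noteq> 0}" for b
  proof -
    have "{p. ?\<phi> b p \<noteq> 0} = (\<lambda>(u, w). (u, w @ [a])) -` {p. coeff (f b) p \<noteq> 0}" by auto
    moreover have "finite \<dots>"
      by (intro finite_vimageI finite_coeff[OF proj_sum_coord[OF G f]]) (auto intro!: injI)
    ultimately show ?thesis by (simp only:)
  qed
  have supp: "b \<in> {b. f b \<noteq> \<zero>\<^bsub>L\<^esub>}" if "?\<phi> b p \<noteq> 0" for b p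
    using that by (cases p) auto
  note * = ex_proj_sum[where \<phi> = ?\<phi>, OF G nf start fin finite_supp[OF f] supp]
  show "strip a f \<in> carrier (P G)" using *(1) unfolding strip_def[abs_def] by simp
  show "coeff (strip a f b) (u, w) = coeff (f b) (u, w @ [a])" using *(2) by (simp add: strip_def)
qed

lemma coeff_arrow_sum:
  assumes "\<And>a. a \<in> arcs Q \<Longrightarrow> h a b \<in> carrier L" "(u, w) \<in> nf"
  shows "(\<Sum>a\<in>arcs Q. coeff ((arrow a \<odot>\<^bsub>P G\<^esub> h a) b) (u, w)) =
    (if w = [] then 0 else coeff (h (last w) b) (u, butlast w))"
proof -
  have "(\<Sum>a\<in>arcs Q. coeff ((arrow a \<odot>\<^bsub>P G\<^esub> h a) b) (u, w)) =
      (\<Sum>a\<in>arcs Q. if a = last w then if w = [] then 0 else coeff (h a b) (u, butlast w) else 0)"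
    using assms by (intro sum.cong refl) (auto simp: proj_sum_simps coeff_arrow_mult)
  moreover have "last w \<in> arcs Q" if "w \<noteq> []"
  proof -
    have "(u, w) \<in> paths Q" using assms(2) nf_paths by blast
    then have "set w \<subseteq> arcs Q" by (auto simp: path_iff awalk_def)
    then show ?thesis using that last_in_set by blast
  qed
  ultimately show ?thesis by auto
qed

lemma arrow_smult:
  "fst ` ran G \<subseteq> verts Q \<Longrightarrow> a \<in> arcs Q \<Longrightarrow> f \<in> carrier (P G) \<Longrightarrow> arrow a \<odot>\<^bsub>P G\<^esub> f \<in> carrier (P G)"
  by (intro proj_sum_smult arrow_closed)

context
  fixes G G' d
  assumes G: "fst ` ran G \<subseteq> verts Q" and G': "fst ` ran G' \<subseteq> verts Q"
    and d: "graded_hom Q I (P G) (P G') d"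
begin

text \<open>
  From \<open>f = \<Sum>\<^sub>a a f\<^sub>a\<close> follows \<open>d f = \<Sum>\<^sub>a a d(f\<^sub>a)\<close>, and only the last arrow of \<open>w\<close> contributes
  to the coefficient at \<open>w\<close>.
\<close>

lemma coeff_hom_strip:
  assumes f: "f \<in> carrier (P G)" "lengths_ge 1 f" and w: "(u, w) \<in> nf"
  shows "coeff (d f b) (u, w) = (if w = [] then 0 else coeff (d (strip (last w) f) b) (u, butlast w))"
proof -
  have coord: "strip a f b \<in> carrier L" for a b using strip(1)[OF G f(1)] G by auto
  have "coeff (f b) (u, w) = (\<Sum>a\<in>arcs Q. coeff ((arrow a \<odot>\<^bsub>P G\<^esub> strip a f) b) (u, w))"
    if "(u, w) \<in> nf" for b u w
    using f(2) unfolding coeff_arrow_sum[OF coord that]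
    by (auto simp: strip(2)[OF G f(1)] lengths_geD)
  then have "coeff (d f b) (u, w) = (\<Sum>a\<in>arcs Q. coeff (d (arrow a \<odot>\<^bsub>P G\<^esub> strip a f) b) (u, w))"
    by (intro hom_sum_eq[OF G G' d]) (simp_all add: f(1) G arrow_smult strip(1))
  also have "\<dots> = (\<Sum>a\<in>arcs Q. coeff ((arrow a \<odot>\<^bsub>P G'\<^esub> d (strip a f)) b) (u, w))"
    using graded_homD(3)[OF d arrow_closed strip(1)[OF G f(1)]] by simp
  finally show ?thesis
    by (simp add: coeff_arrow_sum[OF hom_coord[OF G G' d strip(1)[OF G f(1)]] w])
qed

text \<open>
  Take a nonzero path \<open>w\<close>. If \<open>a w\<close> is nonzero, the coefficient of \<open>d(f\<^sub>a)\<close> at \<open>w\<close> is that of \<open>d f\<close> at \<open>a w\<close>.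
  Otherwise \<open>w\<close> may be assumed to have positive length, as all paths of \<open>f\<^sub>a\<close> do. Then the last arrow \<open>c\<close>
  of \<open>w\<close> already satisfies \<open>a c = 0\<close>, so no path of \<open>f\<^sub>a\<close> ends in \<open>c\<close>, and hence no path of \<open>d(f\<^sub>a)\<close> does.
\<close>

lemma kernel_strip:
  assumes f: "f \<in> carrier (P G)" "lengths_ge 2 f" and df: "d f = \<zero>\<^bsub>P G'\<^esub>"
  shows "d (strip a f) = \<zero>\<^bsub>P G'\<^esub>"
proof (rule proj_sum_eqI)
  let ?h = "strip a f"
  have h: "?h \<in> carrier (P G)" using G f(1) by (rule strip)
  show "d ?h b \<in> carrier L" for b using hom_coord[OF G G' d h] .
  have f1: "lengths_ge 1 f" using f(2) by (simp add: lengths_ge_def)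
  have h1: "lengths_ge 1 ?h"
    using f(2) by (simp add: lengths_ge_def strip(2)[OF G f(1)])
  fix b u w assume w: "(u, w) \<in> nf"
  have "coeff (d ?h b) (u, w) = 0"
  proof (cases "(u, w @ [a]) \<in> nf")
    case True
    have "coeff (d f b) (u, w @ [a]) = 0" by (simp add: df proj_sum_simps)
    then show ?thesis using coeff_hom_strip[OF f(1) f1 True] by simp
  next
    case False
    show ?thesis
    proof (cases w rule: rev_cases)
      case Nil
      then show ?thesis using coeff_hom_strip[OF h h1 w] by simp
    next
      case (snoc v c)
      have ca: "(tail Q c, [c, a]) \<notin> nf"
        using False w nf_snoc2[of u v c a] by (simp add: snoc)
      have "(u', w' @ [c, a]) \<notin> nf" for u' w' using ca nf_snoc2 by blast
      then have "coeff (strip c ?h b') (u', w') = 0" for b' u' w'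
        by (simp add: strip(2)[OF G h] strip(2)[OF G f(1)])
      then have "strip c ?h = \<zero>\<^bsub>P G\<^esub>"
        using proj_sum_coord[OF G strip(1)[OF G h]]
        by (intro proj_sum_eqI) (simp_all add: proj_sum_simps)
      then have "d (strip c ?h) = \<zero>\<^bsub>P G'\<^esub>" using hom_zero[OF G G' d] by simp
      then show ?thesis using coeff_hom_strip[OF h h1 w] by (simp add: snoc proj_sum_simps)
    qed
  qed
  then show "coeff (d ?h b) (u, w) = coeff (\<zero>\<^bsub>P G'\<^esub> b) (u, w)" by (simp add: proj_sum_simps)
qed (simp add: proj_sum_simps)

end

text \<open>
  Lifts \<open>u\<^sub>a\<close> of the elements \<open>f\<^sub>a\<close>, which lie in the kernel again, combine to the lift \<open>\<Sum>\<^sub>a a u\<^sub>a\<close>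
  of \<open>f\<close>, whose paths are longer by one.
\<close>

lemma kernel_lift:
  assumes G: "fst ` ran G \<subseteq> verts Q" "fst ` ran G' \<subseteq> verts Q" "fst ` ran G'' \<subseteq> verts Q"
    and e: "graded_hom Q I (P G) (P G') e" and d: "graded_hom Q I (P G') (P G'') d"
    and exact: "exact_at (P G) e (P G') d (P G'')"
    and f: "f \<in> carrier (P G')" "d f = \<zero>\<^bsub>P G''\<^esub>" "lengths_ge (Suc j) f"
  shows "\<exists>u\<in>carrier (P G). e u = f \<and> lengths_ge j u"
  using f
proof (induction j arbitrary: f)
  case 0
  then have "f \<in> e ` carrier (P G)" using exact by (simp add: exact_at_def)
  then show ?case by (auto simp: lengths_ge_def)
next
  case (Suc j)
  have f2: "lengths_ge 2 f" using Suc.prems(3) by (simp add: lengths_ge_def)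
  have "\<exists>u\<in>carrier (P G). e u = strip a f \<and> lengths_ge j u" for a
    using Suc.prems strip[OF G(2) Suc.prems(1)] kernel_strip[OF G(2,3) d Suc.prems(1) f2 Suc.prems(2)]
    by (intro Suc.IH) (simp_all add: lengths_ge_def)
  then obtain u where u: "\<And>a. u a \<in> carrier (P G)" "\<And>a. e (u a) = strip a f" "\<And>a. lengths_ge j (u a)"
    by metis
  have "arrow a \<odot>\<^bsub>P G\<^esub> u a \<in> carrier (P G)" if "a \<in> arcs Q" for a
    using arrow_smult[OF G(1) that u(1)] .
  from hom_sum[OF G(1,2) e finite_arcs, where g = "\<lambda>a. arrow a \<odot>\<^bsub>P G\<^esub> u a", OF this]
  obtain v where v: "v \<in> carrier (P G)"
    "\<And>b p. coeff (v b) p = (\<Sum>a\<in>arcs Q. coeff ((arrow a \<odot>\<^bsub>P G\<^esub> u a) b) p)"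
    "\<And>b p. coeff (e v b) p = (\<Sum>a\<in>arcs Q. coeff (e (arrow a \<odot>\<^bsub>P G\<^esub> u a) b) p)"
    by blast
  have "e v = f"
  proof (rule proj_sum_eqI)
    fix b p w assume w: "(p, w) \<in> nf"
    have "coeff (e v b) (p, w) = (\<Sum>a\<in>arcs Q. coeff ((arrow a \<odot>\<^bsub>P G'\<^esub> strip a f) b) (p, w))"
      using graded_homD(3)[OF e arrow_closed u(1)] by (simp add: v(3) u(2))
    also have "\<dots> = coeff (f b) (p, w)"
      unfolding coeff_arrow_sum[OF proj_sum_coord[OF G(2) strip(1)[OF G(2) Suc.prems(1)]] w]
      using Suc.prems(3) by (auto simp: strip(2)[OF G(2) Suc.prems(1)] lengths_geD)
    finally show "coeff (e v b) (p, w) = coeff (f b) (p, w)" .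
  qed (use hom_coord[OF G(1,2) e v(1)] proj_sum_coord[OF G(2) Suc.prems(1)] in auto)
  moreover have "lengths_ge (Suc j) v"
    unfolding lengths_ge_def
  proof (intro allI impI)
    fix b p w assume len: "length (w :: 'a list) < Suc j"
    show "coeff (v b) (p, w) = 0"
    proof (cases "(p, w) \<in> nf")
      case True
      show ?thesis
        unfolding v(2) coeff_arrow_sum[OF proj_sum_coord[OF G(1) u(1)] True]
        using len u(3) by (cases w rule: rev_cases) (auto intro: lengths_geD)
    qed simp
  qed
  ultimately show ?case using v(1) by blast
qed

section \<open>The linear part\<close>

definition restr :: "nat set \<Rightarrow> (nat \<Rightarrow> ('v, 'a, 'k) quot) \<Rightarrow> nat \<Rightarrow> ('v, 'a, 'k) quot" where
  "restr N f b = coset Q I (\<lambda>p. if length (snd p) \<in> N then coeff (f b) p else 0)"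

lemma restr:
  assumes G: "fst ` ran G \<subseteq> verts Q" and f: "f \<in> carrier (P G)"
  shows "restr N f \<in> carrier (P G)"
    "coeff (restr N f b) p = (if length (snd p) \<in> N then coeff (f b) p else 0)"
    "{b. restr N f b \<noteq> \<zero>\<^bsub>L\<^esub>} \<subseteq> {b. f b \<noteq> \<zero>\<^bsub>L\<^esub>}"
proof -
  let ?\<phi> = "\<lambda>b p. if length (snd p) \<in> N then coeff (f b) p else 0"
  have nz: "coeff (f b) p \<noteq> 0" if "?\<phi> b p \<noteq> 0" for b p using that by (auto split: if_splits)
  have nf: "p \<in> nf" if "?\<phi> b p \<noteq> 0" for b p using nz[OF that] coeff_outside by blast
  have start: "\<exists>i. G b = Some (u, i)" if "?\<phi> b (u, w) \<noteq> 0" for b u w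
    using nz[OF that] proj_sum_start[OF G f] by blast
  have fin: "finite {p. ?\<phi> b p \<noteq> 0}" for b
  proof -
    have "{p. ?\<phi> b p \<noteq> 0} \<subseteq> {p. coeff (f b) p \<noteq> 0}" by auto
    then show ?thesis using finite_coeff[OF proj_sum_coord[OF G f]] by (rule finite_subset)
  qed
  have supp: "b \<in> {b. f b \<noteq> \<zero>\<^bsub>L\<^esub>}" if "?\<phi> b p \<noteq> 0" for b p using nz[OF that] by auto
  note * = ex_proj_sum[where \<phi> = ?\<phi>, OF G nf start fin finite_supp[OF f] supp]
  show r: "restr N f \<in> carrier (P G)" using *(1) unfolding restr_def[abs_def] by simp
  show c: "coeff (restr N f b) p = (if length (snd p) \<in> N then coeff (f b) p else 0)" for b p
    using *(2) by (simp add: restr_def)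
  have "restr N f b = \<zero>\<^bsub>L\<^esub>" if "f b = \<zero>\<^bsub>L\<^esub>" for b
    using proj_sum_coord[OF G r] c that by (intro coeff_eqI) auto
  then show "{b. restr N f b \<noteq> \<zero>\<^bsub>L\<^esub>} \<subseteq> {b. f b \<noteq> \<zero>\<^bsub>L\<^esub>}" by blast
qed

context
  fixes G G' d
  assumes G: "fst ` ran G \<subseteq> verts Q" and G': "fst ` ran G' \<subseteq> verts Q"
    and d: "graded_hom Q I (P G) (P G') d"
begin

lemma linear_part_restr:
  assumes f: "f \<in> carrier (P G)" and w: "(u, w) \<in> nf"
  shows "coeff (map_part Q I G 1 d (restr N f) b) (u, w) =
    (if w \<noteq> [] \<and> length w - 1 \<in> N then coeff (map_part Q I G 1 d f b) (u, w) else 0)"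
  unfolding linear_part(2)[OF G G' d f finite_supp[OF f] order_refl w]
    linear_part(2)[OF G G' d restr(1)[OF G f] finite_supp[OF f] restr(3)[OF G f] w]
  by (cases "w \<noteq> [] \<and> length w - 1 \<in> N") (auto simp: restr(2)[OF G f] cong: if_cong intro: sum.neutral)

text \<open>
  The entries of the matrix of \<open>d\<close> have no terms of length \<open>0\<close>, so a path of length \<open>j + 1\<close> in \<open>d f\<close> can only
  arise from a path of length \<open>j\<close> in \<open>f\<close> and an arrow in the matrix.
\<close>

lemma leading_part:
  assumes f: "f \<in> carrier (P G)" "lengths_ge j f"
    and min: "\<And>g. g \<in> carrier (P G) \<Longrightarrow> lengths_ge 1 (d g)" and w: "(u, w) \<in> nf"
  shows "length w \<le> j \<Longrightarrow> coeff (d f b) (u, w) = 0"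
    "length w = Suc j \<Longrightarrow> coeff (d f b) (u, w) = coeff (map_part Q I G 1 d f b) (u, w)"
proof -
  let ?t = "\<lambda>a i. coeff (f a) (awlast u (take i w), drop i w) * coeff (d (gen Q I G a) b) (u, take i w)"
  have t: "?t a i = 0" if "i = 0 \<or> length w < i + j" "i \<le> length w" for a i
  proof (cases "i = 0")
    case True
    then show ?thesis using lengths_geD[OF min[OF gen_carrier[OF G]]] by simp
  next
    case False
    then have "length (drop i w) < j" using that by auto
    then show ?thesis using lengths_geD[OF f(2)] by simp
  qed
  note eq = coeff_hom[OF G G' d f(1) finite_supp[OF f(1)] order_refl w]
  show "coeff (d f b) (u, w) = 0" if "length w \<le> j"
    unfolding eq using that by (intro sum.neutral ballI t) auto
  show "coeff (d f b) (u, w) = coeff (map_part Q I G 1 d f b) (u, w)" if len: "length w = Suc j"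
    unfolding eq linear_part(2)[OF G G' d f(1) finite_supp[OF f(1)] order_refl w]
  proof (intro sum.cong refl)
    fix a
    have "(\<Sum>i\<le>length w. ?t a i) = (\<Sum>i\<le>length w. if i = 1 then ?t a 1 else 0)"
    proof (intro sum.cong refl)
      fix i assume "i \<in> {..length w}"
      then have "?t a i = 0" if "i \<noteq> 1" using that len by (intro t) auto
      then show "?t a i = (if i = 1 then ?t a 1 else 0)" by (cases "i = 1") simp_all
    qed
    then show "(\<Sum>i\<le>length w. ?t a i) = (if w = [] then 0 else ?t a 1)"
      using len by auto
  qed
qed

end

text \<open>
  The lift \<open>g\<close> of \<open>d f\<close> corrects \<open>f\<close> to an element \<open>f - g\<close> of the kernel of \<open>d\<close> without changing
  its part of length \<open>j\<close>, since the paths of \<open>g\<close> are longer than \<open>j\<close>.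
\<close>

lemma linear_part_exact_homogeneous:
  assumes G: "fst ` ran G3 \<subseteq> verts Q" "fst ` ran G2 \<subseteq> verts Q" "fst ` ran G1 \<subseteq> verts Q"
      "fst ` ran G0 \<subseteq> verts Q"
    and c: "graded_hom Q I (P G3) (P G2) c" and d: "graded_hom Q I (P G2) (P G1) d"
    and e: "graded_hom Q I (P G1) (P G0) e"
    and exact: "exact_at (P G3) c (P G2) d (P G1)" "exact_at (P G2) d (P G1) e (P G0)"
    and min: "\<And>g. g \<in> carrier (P G3) \<Longrightarrow> lengths_ge 1 (c g)"
      "\<And>g. g \<in> carrier (P G2) \<Longrightarrow> lengths_ge 1 (d g)"
    and f: "f \<in> carrier (P G2)" "map_part Q I G2 1 d f = \<zero>\<^bsub>P G1\<^esub>"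
    and homogeneous: "\<And>b u w. coeff (f b) (u, w) \<noteq> 0 \<Longrightarrow> length w = j"
  shows "\<exists>v\<in>carrier (P G3). map_part Q I G3 1 c v = f"
proof -
  have fj: "lengths_ge j f"
    unfolding lengths_ge_def using homogeneous by (metis less_irrefl)
  have "lengths_ge (Suc (Suc j)) (d f)"
    unfolding lengths_ge_def
  proof (intro allI impI)
    fix b u w assume "length (w :: 'a list) < Suc (Suc j)"
    then consider "(u, w) \<notin> nf" | "(u, w) \<in> nf" "length w \<le> j" | "(u, w) \<in> nf" "length w = Suc j"
      by linarith
    then show "coeff (d f b) (u, w) = 0"
    proof cases
      case 2
      then show ?thesis using leading_part(1)[OF G(2,3) d f(1) fj min(2)] by blast
    next
      case 3
      then have "coeff (d f b) (u, w) = coeff (map_part Q I G2 1 d f b) (u, w)"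
        using leading_part(2)[OF G(2,3) d f(1) fj min(2)] by blast
      then show ?thesis unfolding f(2) by (simp add: proj_sum_simps)
    qed simp
  qed
  moreover have "d f \<in> carrier (P G1)" "e (d f) = \<zero>\<^bsub>P G0\<^esub>"
    using f(1) exact(2) unfolding exact_at_def by blast+
  ultimately obtain g where g: "g \<in> carrier (P G2)" "d g = d f" "lengths_ge (Suc j) g"
    using kernel_lift[OF G(2,3,4) d e exact(2)] by blast
  obtain h where h: "h \<in> carrier (P G2)" "f = h \<oplus>\<^bsub>P G2\<^esub> g"
    "\<And>b p. coeff (h b) p = coeff (f b) p - coeff (g b) p"
    using ex_proj_sum_diff[OF G(2) f(1) g(1)] by blast
  have df: "d f = d h \<oplus>\<^bsub>P G1\<^esub> d g" using graded_homD(2)[OF d h(1) g(1)] h(2) by simp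
  have "d h = \<zero>\<^bsub>P G1\<^esub>"
  proof (rule proj_sum_eqI)
    show "d h b \<in> carrier L" for b using hom_coord[OF G(2,3) d h(1)] .
    fix b u w
    have "d f b = d h b \<oplus>\<^bsub>L\<^esub> d g b" using fun_cong[OF df, of b] by (simp only: proj_sum_simps(2))
    then have "coeff (d f b) (u, w) = coeff (d h b) (u, w) + coeff (d f b) (u, w)"
      using hom_coord[OF G(2,3) d] h(1) g(1,2) by (metis coeff_add)
    then show "coeff (d h b) (u, w) = coeff (\<zero>\<^bsub>P G1\<^esub> b) (u, w)" by (simp add: proj_sum_simps)
  qed (simp add: proj_sum_simps)
  have hj: "lengths_ge j h"
    using fj g(3) by (simp add: lengths_ge_def h(3))
  show ?thesis
  proof (cases j)
    case 0
    have "h \<in> c ` carrier (P G3)"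
      using exact(1) h(1) \<open>d h = _\<close> unfolding exact_at_def by blast
    then have h1: "lengths_ge 1 h" using min(1) by blast
    have "coeff (f b) (u, w) = 0" for b u w
    proof (cases w)
      case Nil
      have "coeff (h b) (u, w) = 0" "coeff (g b) (u, w) = 0"
        using lengths_geD[OF h1] lengths_geD[OF g(3)] by (simp_all add: Nil 0)
      then show ?thesis using h(3)[of b "(u, w)"] by simp
    next
      case (Cons x xs)
      then show ?thesis using homogeneous[of b u w] 0 by auto
    qed
    then have "f = (\<lambda>_. \<zero>\<^bsub>L\<^esub>)"
      using proj_sum_coord[OF G(2) f(1)] by (intro proj_sum_eqI) simp_all
    moreover have "map_part Q I G3 1 c \<zero>\<^bsub>P G3\<^esub> = (\<lambda>_. \<zero>\<^bsub>L\<^esub>)"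
      by (simp add: map_part_def Let_def proj_sum_simps)
    ultimately show ?thesis using proj_sum_zero[OF G(1)] by blast
  next
    case (Suc i)
    obtain v where v: "v \<in> carrier (P G3)" "c v = h" "lengths_ge i v"
      using kernel_lift[OF G(1,2,3) c d exact(1) h(1) \<open>d h = _\<close>] hj Suc by blast
    have "map_part Q I G3 1 c (restr {i} v) = f"
    proof (rule proj_sum_eqI)
      show "map_part Q I G3 1 c (restr {i} v) b \<in> carrier L" for b
        by (rule linear_part(1)[OF G(1,2) c restr(1)[OF G(1) v(1)]])
      show "f b \<in> carrier L" for b using proj_sum_coord[OF G(2) f(1)] .
      fix b u w assume w: "(u, w) \<in> nf"
      show "coeff (map_part Q I G3 1 c (restr {i} v) b) (u, w) = coeff (f b) (u, w)"
      proof (cases "length w = j")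
        case True
        then have len: "length w = Suc i" using Suc by simp
        have "coeff (map_part Q I G3 1 c (restr {i} v) b) (u, w) = coeff (map_part Q I G3 1 c v b) (u, w)"
          unfolding linear_part_restr[OF G(1,2) c v(1) w] using len by auto
        also have "\<dots> = coeff (h b) (u, w)"
          using leading_part(2)[OF G(1,2) c v(1,3) min(1) w len] v(2) by simp
        also have "\<dots> = coeff (f b) (u, w)"
          using lengths_geD[OF g(3), of w b u] True by (simp add: h(3))
        finally show ?thesis .
      next
        case False
        then have "coeff (f b) (u, w) = 0" using homogeneous by blast
        moreover have "\<not> (w \<noteq> [] \<and> length w - 1 \<in> {i})" using False Suc by (cases w) auto
        ultimately show ?thesis unfolding linear_part_restr[OF G(1,2) c v(1) w] by (simp only: if_False)
      qed
    qed
    then show ?thesis using restr(1)[OF G(1) v(1)] by blast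
  qed
qed

text \<open>
  The parts of a cocycle of the linear part in the different lengths are cocycles, and there are
  finitely many of them.
\<close>

lemma linear_part_exact:
  assumes G: "fst ` ran G3 \<subseteq> verts Q" "fst ` ran G2 \<subseteq> verts Q" "fst ` ran G1 \<subseteq> verts Q"
      "fst ` ran G0 \<subseteq> verts Q"
    and c: "graded_hom Q I (P G3) (P G2) c" and d: "graded_hom Q I (P G2) (P G1) d"
    and e: "graded_hom Q I (P G1) (P G0) e"
    and exact: "exact_at (P G3) c (P G2) d (P G1)" "exact_at (P G2) d (P G1) e (P G0)"
    and min: "\<And>g. g \<in> carrier (P G3) \<Longrightarrow> lengths_ge 1 (c g)"
      "\<And>g. g \<in> carrier (P G2) \<Longrightarrow> lengths_ge 1 (d g)"
    and f: "f \<in> carrier (P G2)" "map_part Q I G2 1 d f = \<zero>\<^bsub>P G1\<^esub>"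
  shows "\<exists>v\<in>carrier (P G3). map_part Q I G3 1 c v = f"
proof -
  have cocycle: "map_part Q I G2 1 d (restr N g) = \<zero>\<^bsub>P G1\<^esub>"
    if g: "g \<in> carrier (P G2)" "map_part Q I G2 1 d g = \<zero>\<^bsub>P G1\<^esub>" for N g
  proof (rule proj_sum_eqI)
    show "map_part Q I G2 1 d (restr N g) b \<in> carrier L" for b
      by (rule linear_part(1)[OF G(2,3) d restr(1)[OF G(2) g(1)]])
    fix b u w assume "(u, w) \<in> nf"
    then show "coeff (map_part Q I G2 1 d (restr N g) b) (u, w) = coeff (\<zero>\<^bsub>P G1\<^esub> b) (u, w)"
      unfolding linear_part_restr[OF G(2,3) d g(1) \<open>(u, w) \<in> nf\<close>] g(2)
      by (simp add: proj_sum_simps)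
  qed (simp add: proj_sum_simps)
  have bounded: "\<exists>v\<in>carrier (P G3). map_part Q I G3 1 c v = restr {..<n} f" for n
  proof (induction n)
    case 0
    have "restr {..<0} f = (\<lambda>_. \<zero>\<^bsub>L\<^esub>)"
      using restr(1)[OF G(2) f(1)] G(2)
      by (intro proj_sum_eqI) (simp_all add: proj_sum_coord restr(2)[OF G(2) f(1)])
    moreover have "map_part Q I G3 1 c \<zero>\<^bsub>P G3\<^esub> = (\<lambda>_. \<zero>\<^bsub>L\<^esub>)"
      by (simp add: map_part_def Let_def proj_sum_simps)
    ultimately show ?case using proj_sum_zero[OF G(1)] by metis
  next
    case (Suc n)
    then obtain v where v: "v \<in> carrier (P G3)" "map_part Q I G3 1 c v = restr {..<n} f" by blast
    have "length w = n" if "coeff (restr {n} f b) (u, w) \<noteq> 0" for b u w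
      using that by (auto simp: restr(2)[OF G(2) f(1)] split: if_splits)
    with linear_part_exact_homogeneous[where j = n and f = "restr {n} f",
        OF G c d e exact min restr(1)[OF G(2) f(1)] cocycle[OF f]]
    obtain v' where v': "v' \<in> carrier (P G3)" "map_part Q I G3 1 c v' = restr {n} f" by blast
    have "restr {..<n} f \<oplus>\<^bsub>P G2\<^esub> restr {n} f = restr {..<Suc n} f"
    proof (rule proj_sum_eqI)
      fix b u w
      show "coeff ((restr {..<n} f \<oplus>\<^bsub>P G2\<^esub> restr {n} f) b) (u, w) = coeff (restr {..<Suc n} f b) (u, w)"
        unfolding proj_sum_simps(2)
        using proj_sum_coord[OF G(2) restr(1)[OF G(2) f(1)]]
        by (auto simp: coeff_add restr(2)[OF G(2) f(1)])
    qed (auto intro!: proj_sum_coord[OF G(2)] proj_sum_add[OF G(2)] restr(1)[OF G(2) f(1)])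
    then have "map_part Q I G3 1 c (v \<oplus>\<^bsub>P G3\<^esub> v') = restr {..<Suc n} f"
      using linear_part_add[OF G(1,2) c v(1) v'(1)] v(2) v'(2) by simp
    then show ?case using proj_sum_add[OF G(1) v(1) v'(1)] by blast
  qed
  define S where "S = (\<Union>b\<in>{b. f b \<noteq> \<zero>\<^bsub>L\<^esub>}. (\<lambda>p. length (snd p)) ` {p. coeff (f b) p \<noteq> 0})"
  have "finite S"
    unfolding S_def using finite_supp[OF f(1)] finite_coeff[OF proj_sum_coord[OF G(2) f(1)]] by blast
  then obtain n where n: "\<forall>l\<in>S. l < n" using finite_nat_set_iff_bounded by blast
  have "restr {..<n} f = f"
  proof (rule proj_sum_eqI)
    fix b u w
    have "length w \<in> S" if nz: "coeff (f b) (u, w) \<noteq> 0"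
    proof -
      have "f b \<noteq> \<zero>\<^bsub>L\<^esub>" using nz coeff_zero by metis
      then show ?thesis unfolding S_def using nz by force
    qed
    then show "coeff (restr {..<n} f b) (u, w) = coeff (f b) (u, w)"
      using n by (auto simp: restr(2)[OF G(2) f(1)])
  qed (auto intro!: proj_sum_coord[OF G(2)] restr(1)[OF G(2) f(1)] f(1))
  then show ?thesis using bounded[of n] by simp
qed

text \<open>
  For \<open>i \<ge> 2\<close> the two maps that follow \<open>P\<^sup>-\<^sup>i\<close> are differentials between projectives. For \<open>i = 1\<close> the
  second one would be the augmentation to \<open>M\<close>, to which \<open>kernel_lift\<close> does not apply.
\<close>

lemma lin_cohomology_trivial:
  assumes res: "minimal_resolution Q I M G d h" and i: "2 \<le> i"
  shows "carrier (lin_cohomology Q I G d i) = {\<one>\<^bsub>lin_cohomology Q I G d i\<^esub>}"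
proof -
  obtain k where k: "i = Suc (Suc k)" using i by (metis add_2_eq_Suc le_Suc_ex)
  have G: "fst ` ran (G n) \<subseteq> verts Q" and d: "graded_hom Q I (P (G (Suc n))) (P (G n)) (d n)"
    and exact: "exact_at (P (G (Suc (Suc n)))) (d (Suc n)) (P (G (Suc n))) (d n) (P (G n))"
    for n
    using res by (auto simp: minimal_resolution_def Let_def)
  have min: "lengths_ge 1 (d n g)" if "g \<in> carrier (P (G (Suc n)))" for n g
    using res that by (simp add: minimal_resolution_def Let_def lengths_ge_def arrow_ideal_coeff)
  let ?D = "map_part Q I (G (Suc i)) 1 (d i)"
  define B where "B = lin_coboundaries Q I G d i"
  have B: "B = ?D ` carrier (P (G (Suc i)))" by (simp add: B_def lin_coboundaries_def)
  have cocycle: "f \<in> B" if "f \<in> lin_cocycles Q I G d i" for f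
  proof -
    have "\<exists>v\<in>carrier (P (G (Suc i))). ?D v = f"
      unfolding k
    proof (rule linear_part_exact)
      show "f \<in> carrier (P (G (Suc (Suc k))))"
        "map_part Q I (G (Suc (Suc k))) 1 (d (Suc k)) f = \<zero>\<^bsub>P (G (Suc k))\<^esub>"
        using that by (simp_all add: k lin_cocycles_def)
      show "graded_hom Q I (P (G (Suc k))) (P (G k)) (d k)" by (rule d)
    qed (rule G d exact min; assumption)+
    then show ?thesis unfolding B by blast
  qed
  have coset_B: "(\<Union>g\<in>B. {g \<oplus>\<^bsub>P (G i)\<^esub> f}) = B" if f: "f \<in> B" for f
  proof -
    obtain v where v: "v \<in> carrier (P (G (Suc i)))" "f = ?D v" using f unfolding B by blast
    have "?D u \<oplus>\<^bsub>P (G i)\<^esub> f \<in> B" if "u \<in> carrier (P (G (Suc i)))" for u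
      using linear_part_add[OF G G d that v(1)] proj_sum_add[OF G that v(1)]
      unfolding B v(2) by (metis imageI)
    moreover have "\<exists>g\<in>B. ?D u = g \<oplus>\<^bsub>P (G i)\<^esub> f" if u: "u \<in> carrier (P (G (Suc i)))" for u
    proof -
      obtain u' where u': "u' \<in> carrier (P (G (Suc i)))" "u = u' \<oplus>\<^bsub>P (G (Suc i))\<^esub> v"
        by (rule ex_proj_sum_diff[OF G u v(1)]) (rule that; assumption)
      then have "?D u = ?D u' \<oplus>\<^bsub>P (G i)\<^esub> f" using linear_part_add[OF G G d u'(1) v(1)] v(2) by simp
      moreover have "?D u' \<in> B" using u'(1) unfolding B by (rule imageI)
      ultimately show ?thesis by (rule bexI)
    qed
    ultimately show ?thesis unfolding B by fast
  qed
  have zero: "\<zero>\<^bsub>P (G i)\<^esub> \<in> lin_cocycles Q I G d i"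
    using proj_sum_zero[OF G[of i]] by (simp add: lin_cocycles_def k map_part_def Let_def proj_sum_simps)
  have "(\<Union>f\<in>lin_cocycles Q I G d i. {\<Union>g\<in>B. {g \<oplus>\<^bsub>P (G i)\<^esub> f}}) = {B}"
    using coset_B cocycle zero by auto
  then show ?thesis
    by (simp add: lin_cohomology_def FactGroup_def RCOSETS_def r_coset_def B_def)
qed

lemma linearity_defect_le_1: "linearity_defect Q I M \<le> 1"
  unfolding linearity_defect_def
proof (rule Sup_least, clarify)
  fix i G d h
  assume res: "minimal_resolution Q I M G d h"
    and nz: "carrier (lin_cohomology Q I G d i) \<noteq> {\<one>\<^bsub>lin_cohomology Q I G d i\<^esub>}"
  then have "\<not> 2 \<le> i" using lin_cohomology_trivial by blast
  then show "enat i \<le> 1" by (simp add: one_enat_def)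
qed

end

theorem theorem3p4:
  fixes Q :: "('v, 'a) pre_digraph"
    and I :: "(('v, 'a) path \<Rightarrow> 'k::field) set"
  assumes "fin_digraph Q"
    and "quadratic_monomial_ideal Q I"
  shows "absolutely_Koszul Q I TYPE('m) \<and> global_linearity_defect Q I TYPE('m) \<le> 1"
proof -
  obtain R where "R \<subseteq> {p \<in> paths Q. length (snd p) = 2}" "I = genideal (path_algebra Q) (path_elem ` R)"
    using assms(2) by (auto simp: quadratic_monomial_ideal_def)
  then interpret quadratic_monomial Q R I
    using assms(1) by (simp add: quadratic_monomial_def quadratic_monomial_axioms_def)
  have "linearity_defect Q I M < \<infinity>" for M :: "(('v, 'a, 'k) quot, 'm) gmodule"
    using linearity_defect_le_1[of M] by (rule le_less_trans) simp
  moreover have "global_linearity_defect Q I TYPE('m) \<le> 1"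
    unfolding global_linearity_defect_def using linearity_defect_le_1 by (auto intro!: Sup_least)
  ultimately show ?thesis by (simp add: absolutely_Koszul_def)
qed

end
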